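(* Let $\mathbb{X}$ be a semi-abelian category. For each $n\in\mathbb{Z}$: 1. The pair $(\mathrm{Ker}(\mathbf{cot}_{n-1}), ch(\mathbb{X})_{n-1\geq})$ of subcategories of $ch(\mathbb{X})$ satisfies axiom TT1 of a torsion theory. 2. The pair $(\mathcal{EP}_n, pch(\mathbb{X})_{n-1\geq})$ of subcategories of $pch(\mathbb{X})$ is a torsion theory in $pch(\mathbb{X})$.
   Context: A chain complex $M$ in $\mathbb{X}$ is a family of morphisms $\delta_i:M_i\to M_{i-1}$ ($i\in\mathbb{Z}$) with $\delta_i\delta_{i+1}=0$; it is proper if in each normal epi/mono factorization $\delta_i=m_ie_i$ the image $m_i$ is a normal monomorphism. $ch(\mathbb{X})$ is the (semi-abelian) category of chain complexes and $pch(\mathbb{X})$ its full subcategory of proper chain complexes. A short exact sequence in $pch(\mathbb{X})$ means a short exact sequence in $ch(\mathbb{X})$ all of whose terms are proper. A torsion theory is a pair $(\mathcal{T},\mathcal{F})$ of full replete subcategories such that (TT1) every morphism $T\to F$ with $T\in\mathcal{T}$, $F\in\mathcal{F}$ is zero; (TT2) every object $X$ admits a short exact sequence $0\to T_X\to X\to F_X\to0$ with $T_X\in\mathcal{T}$, $F_X\in\mathcal{F}$. $ch(\mathbb{X})_{n-1\geq}$ (resp. $pch(\mathbb{X})_{n-1\geq}$) is the full subcategory of (proper) chain complexes with $M_i=0$ for $i>n-1$. The cotruncation functor $\mathbf{cot}_{n-1}: ch(\mathbb{X})\to ch(\mathbb{X})_{n-1\geq}$ sends $M$ to $\mathrm{Cok}(\delta_n)\to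 M_{n-2}\to M_{n-3}\to\dots$ (with $\mathrm{Cok}(\delta_n)$ in degree $n-1$ and first map induced by $\delta_{n-1}$); $\mathrm{Ker}(\mathbf{cot}_{n-1})=\{M\mid\mathbf{cot}_{n-1}(M)\cong0\}$. $\mathcal{EP}_n$ is the full subcategory of $pch(\mathbb{X})$ of those $M$ with $\delta_n$ a normal epimorphism and $M_i=0$ for $i<n-1$. *)

theory Defs
  imports Main
begin

section \<open>Categories\<close>

record ('o, 'm) cat =
  Ob :: "'o set"
  Ar :: "'m set"
  Dom :: "'m \<Rightarrow> 'o"
  Cod :: "'m \<Rightarrow> 'o"
  Id :: "'o \<Rightarrow> 'm"
  Cmp :: "'m \<Rightarrow> 'm \<Rightarrow> 'm"  (infixl "\<cdot>\<index>" 70)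

definition Hom :: "('o, 'm) cat \<Rightarrow> 'o \<Rightarrow> 'o \<Rightarrow> 'm set" where
  "Hom C a b = {f \<in> Ar C. Dom C f = a \<and> Cod C f = b}"

locale category =
  fixes C :: "('o, 'm) cat" (structure)
  assumes dom_closed: "f \<in> Ar C \<Longrightarrow> Dom C f \<in> Ob C"
    and cod_closed: "f \<in> Ar C \<Longrightarrow> Cod C f \<in> Ob C"
    and id_closed: "a \<in> Ob C \<Longrightarrow> Id C a \<in> Hom C a a"
    and comp_closed: "f \<in> Hom C a b \<Longrightarrow> g \<in> Hom C b c \<Longrightarrow> g \<cdot> f \<in> Hom C a c"
    and id_left: "f \<in> Hom C a b \<Longrightarrow> Id C b \<cdot> f = f"
    and id_right: "f \<in> Hom C a b \<Longrightarrow> f \<cdot> Id C a = f"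
    and comp_assoc:
      "f \<in> Hom C a b \<Longrightarrow> g \<in> Hom C b c \<Longrightarrow> h \<in> Hom C c d \<Longrightarrow> h \<cdot> (g \<cdot> f) = (h \<cdot> g) \<cdot> f"

definition full_subcat :: "('o, 'm) cat \<Rightarrow> 'o set \<Rightarrow> ('o, 'm) cat" where
  "full_subcat C S = C\<lparr>Ob := Ob C \<inter> S, Ar := {f \<in> Ar C. Dom C f \<in> S \<and> Cod C f \<in> S}\<rparr>"

definition mono_arr :: "('o, 'm) cat \<Rightarrow> 'm \<Rightarrow> bool" where
  "mono_arr C m \<longleftrightarrow> m \<in> Ar C \<and>
     (\<forall>a. \<forall>u \<in> Hom C a (Dom C m). \<forall>v \<in> Hom C a (Dom C m).
        m \<cdot>\<^bsub>C\<^esub> u = m \<cdot>\<^bsub>C\<^esub> v \<longrightarrow> u = v)"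

definition iso_arr :: "('o, 'm) cat \<Rightarrow> 'm \<Rightarrow> bool" where
  "iso_arr C f \<longleftrightarrow> f \<in> Ar C \<and>
     (\<exists>g \<in> Hom C (Cod C f) (Dom C f).
        g \<cdot>\<^bsub>C\<^esub> f = Id C (Dom C f) \<and> f \<cdot>\<^bsub>C\<^esub> g = Id C (Cod C f))"

definition isomorphic :: "('o, 'm) cat \<Rightarrow> 'o \<Rightarrow> 'o \<Rightarrow> bool" where
  "isomorphic C a b \<longleftrightarrow> (\<exists>f \<in> Hom C a b. iso_arr C f)"


section \<open>Limits and colimits\<close>

text \<open>A finite diagram is given by a finite graph with vertices \<open>V\<close>, edges \<open>E\<close>, source and target
  maps \<open>s\<close>, \<open>t\<close>, and a labelling of vertices and edges by objects \<open>D\<close> and arrows \<open>d\<close>.  A diagram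
  on a category has the same cones as the diagram on its underlying graph.\<close>

definition diagram ::
  "('o, 'm) cat \<Rightarrow> nat set \<Rightarrow> nat set \<Rightarrow> (nat \<Rightarrow> nat) \<Rightarrow> (nat \<Rightarrow> nat) \<Rightarrow> (nat \<Rightarrow> 'o) \<Rightarrow> (nat \<Rightarrow> 'm) \<Rightarrow> bool"
where
  "diagram C V E s t D d \<longleftrightarrow>
     (\<forall>v\<in>V. D v \<in> Ob C) \<and>
     (\<forall>e\<in>E. s e \<in> V \<and> t e \<in> V \<and> d e \<in> Hom C (D (s e)) (D (t e)))"

definition cone ::
  "('o, 'm) cat \<Rightarrow> nat set \<Rightarrow> nat set \<Rightarrow> (nat \<Rightarrow> nat) \<Rightarrow> (nat \<Rightarrow> nat) \<Rightarrow> (nat \<Rightarrow> 'o) \<Rightarrow> (nat \<Rightarrow> 'm) \<Rightarrow>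
     'o \<Rightarrow> (nat \<Rightarrow> 'm) \<Rightarrow> bool"
where
  "cone C V E s t D d a p \<longleftrightarrow> a \<in> Ob C \<and>
     (\<forall>v\<in>V. p v \<in> Hom C a (D v)) \<and> (\<forall>e\<in>E. d e \<cdot>\<^bsub>C\<^esub> p (s e) = p (t e))"

definition limit_cone ::
  "('o, 'm) cat \<Rightarrow> nat set \<Rightarrow> nat set \<Rightarrow> (nat \<Rightarrow> nat) \<Rightarrow> (nat \<Rightarrow> nat) \<Rightarrow> (nat \<Rightarrow> 'o) \<Rightarrow> (nat \<Rightarrow> 'm) \<Rightarrow>
     'o \<Rightarrow> (nat \<Rightarrow> 'm) \<Rightarrow> bool"
where
  "limit_cone C V E s t D d a p \<longleftrightarrow> cone C V E s t D d a p \<and>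
     (\<forall>b q. cone C V E s t D d b q \<longrightarrow>
        (\<exists>!h. h \<in> Hom C b a \<and> (\<forall>v\<in>V. p v \<cdot>\<^bsub>C\<^esub> h = q v)))"

definition finitely_complete :: "('o, 'm) cat \<Rightarrow> bool" where
  "finitely_complete C \<longleftrightarrow>
     (\<forall>V E s t D d. finite V \<and> finite E \<and> diagram C V E s t D d \<longrightarrow>
        (\<exists>a p. limit_cone C V E s t D d a p))"

text \<open>The square \<open>f p = g q\<close> is a pullback; \<open>pullback C f f r1 r2\<close> says that \<open>(r1, r2)\<close> is a kernel
  pair of \<open>f\<close>.\<close>

definition pullback :: "('o, 'm) cat \<Rightarrow> 'm \<Rightarrow> 'm \<Rightarrow> 'm \<Rightarrow> 'm \<Rightarrow> bool" where
  "pullback C f g p q \<longleftrightarrow>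
     f \<in> Ar C \<and> g \<in> Ar C \<and> Cod C f = Cod C g \<and>
     p \<in> Ar C \<and> q \<in> Hom C (Dom C p) (Dom C g) \<and> Cod C p = Dom C f \<and>
     f \<cdot>\<^bsub>C\<^esub> p = g \<cdot>\<^bsub>C\<^esub> q \<and>
     (\<forall>a. \<forall>u \<in> Hom C a (Dom C f). \<forall>v \<in> Hom C a (Dom C g).
        f \<cdot>\<^bsub>C\<^esub> u = g \<cdot>\<^bsub>C\<^esub> v \<longrightarrow>
        (\<exists>!h. h \<in> Hom C a (Dom C p) \<and> p \<cdot>\<^bsub>C\<^esub> h = u \<and> q \<cdot>\<^bsub>C\<^esub> h = v))"

definition coequalizer :: "('o, 'm) cat \<Rightarrow> 'm \<Rightarrow> 'm \<Rightarrow> 'm \<Rightarrow> bool" where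
  "coequalizer C f g q \<longleftrightarrow>
     f \<in> Ar C \<and> g \<in> Hom C (Dom C f) (Cod C f) \<and> q \<in> Ar C \<and> Dom C q = Cod C f \<and>
     q \<cdot>\<^bsub>C\<^esub> f = q \<cdot>\<^bsub>C\<^esub> g \<and>
     (\<forall>c. \<forall>u \<in> Hom C (Cod C f) c. u \<cdot>\<^bsub>C\<^esub> f = u \<cdot>\<^bsub>C\<^esub> g \<longrightarrow>
        (\<exists>!h. h \<in> Hom C (Cod C q) c \<and> h \<cdot>\<^bsub>C\<^esub> q = u))"

definition regular_epi :: "('o, 'm) cat \<Rightarrow> 'm \<Rightarrow> bool" where
  "regular_epi C q \<longleftrightarrow> (\<exists>f g. coequalizer C f g q)"

definition has_binary_coproducts :: "('o, 'm) cat \<Rightarrow> bool" where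
  "has_binary_coproducts C \<longleftrightarrow>
     (\<forall>a\<in>Ob C. \<forall>b\<in>Ob C. \<exists>c\<in>Ob C. \<exists>i \<in> Hom C a c. \<exists>j \<in> Hom C b c.
        \<forall>d. \<forall>f \<in> Hom C a d. \<forall>g \<in> Hom C b d.
          \<exists>!h. h \<in> Hom C c d \<and> h \<cdot>\<^bsub>C\<^esub> i = f \<and> h \<cdot>\<^bsub>C\<^esub> j = g)"


section \<open>Pointed categories\<close>

definition zero_obj :: "('o, 'm) cat \<Rightarrow> 'o \<Rightarrow> bool" where
  "zero_obj C z \<longleftrightarrow> z \<in> Ob C \<and>
     (\<forall>a\<in>Ob C. (\<exists>!f. f \<in> Hom C z a) \<and> (\<exists>!f. f \<in> Hom C a z))"

definition pointed :: "('o, 'm) cat \<Rightarrow> bool" where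
  "pointed C \<longleftrightarrow> (\<exists>z. zero_obj C z)"

definition zero_arr :: "('o, 'm) cat \<Rightarrow> 'm \<Rightarrow> bool" where
  "zero_arr C f \<longleftrightarrow> f \<in> Ar C \<and>
     (\<exists>z. zero_obj C z \<and>
        (\<exists>g \<in> Hom C (Dom C f) z. \<exists>h \<in> Hom C z (Cod C f). f = h \<cdot>\<^bsub>C\<^esub> g))"

definition is_kernel :: "('o, 'm) cat \<Rightarrow> 'm \<Rightarrow> 'm \<Rightarrow> bool" where
  "is_kernel C f k \<longleftrightarrow>
     f \<in> Ar C \<and> k \<in> Ar C \<and> Cod C k = Dom C f \<and> zero_arr C (f \<cdot>\<^bsub>C\<^esub> k) \<and>
     (\<forall>a. \<forall>u \<in> Hom C a (Dom C f). zero_arr C (f \<cdot>\<^bsub>C\<^esub> u) \<longrightarrow>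
        (\<exists>!h. h \<in> Hom C a (Dom C k) \<and> k \<cdot>\<^bsub>C\<^esub> h = u))"

definition is_cokernel :: "('o, 'm) cat \<Rightarrow> 'm \<Rightarrow> 'm \<Rightarrow> bool" where
  "is_cokernel C f q \<longleftrightarrow>
     f \<in> Ar C \<and> q \<in> Ar C \<and> Dom C q = Cod C f \<and> zero_arr C (q \<cdot>\<^bsub>C\<^esub> f) \<and>
     (\<forall>b. \<forall>u \<in> Hom C (Cod C f) b. zero_arr C (u \<cdot>\<^bsub>C\<^esub> f) \<longrightarrow>
        (\<exists>!h. h \<in> Hom C (Cod C q) b \<and> h \<cdot>\<^bsub>C\<^esub> q = u))"

definition normal_mono :: "('o, 'm) cat \<Rightarrow> 'm \<Rightarrow> bool" where
  "normal_mono C k \<longleftrightarrow> (\<exists>f. is_kernel C f k)"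

definition normal_epi :: "('o, 'm) cat \<Rightarrow> 'm \<Rightarrow> bool" where
  "normal_epi C q \<longleftrightarrow> (\<exists>f. is_cokernel C f q)"

text \<open>\<open>0 \<rightarrow> a \<rightarrow> b \<rightarrow> c \<rightarrow> 0\<close> with arrows \<open>k\<close> and \<open>q\<close>.\<close>

definition short_exact :: "('o, 'm) cat \<Rightarrow> 'm \<Rightarrow> 'm \<Rightarrow> bool" where
  "short_exact C k q \<longleftrightarrow> is_kernel C q k \<and> is_cokernel C k q"


section \<open>Semi-abelian categories\<close>

definition regular_cat :: "('o, 'm) cat \<Rightarrow> bool" where
  "regular_cat C \<longleftrightarrow> finitely_complete C \<and>
     (\<forall>f r1 r2. pullback C f f r1 r2 \<longrightarrow> (\<exists>q. coequalizer C r1 r2 q)) \<and>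
     (\<forall>f g p q. pullback C f g p q \<and> regular_epi C f \<longrightarrow> regular_epi C q)"

text \<open>An internal equivalence relation on \<open>a\<close> is a jointly monic pair inducing an equivalence
  relation on each set \<open>Hom C z a\<close>.\<close>

definition equivalence_relation :: "('o, 'm) cat \<Rightarrow> 'o \<Rightarrow> 'm \<Rightarrow> 'm \<Rightarrow> bool" where
  "equivalence_relation C a r1 r2 \<longleftrightarrow>
     (\<exists>r. r1 \<in> Hom C r a \<and> r2 \<in> Hom C r a \<and>
        (\<forall>z. \<forall>x \<in> Hom C z r. \<forall>y \<in> Hom C z r.
           r1 \<cdot>\<^bsub>C\<^esub> x = r1 \<cdot>\<^bsub>C\<^esub> y \<and> r2 \<cdot>\<^bsub>C\<^esub> x = r2 \<cdot>\<^bsub>C\<^esub> y \<longrightarrow> x = y) \<and>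
        (\<forall>z\<in>Ob C. equiv (Hom C z a) {(r1 \<cdot>\<^bsub>C\<^esub> x, r2 \<cdot>\<^bsub>C\<^esub> x) | x. x \<in> Hom C z r}))"

definition barr_exact :: "('o, 'm) cat \<Rightarrow> bool" where
  "barr_exact C \<longleftrightarrow> regular_cat C \<and>
     (\<forall>a r1 r2. equivalence_relation C a r1 r2 \<longrightarrow> (\<exists>f. pullback C f f r1 r2))"

text \<open>A point over \<open>b\<close> is a split epimorphism \<open>p\<close> with codomain \<open>b\<close> together with a section \<open>s\<close>.
  Bourn protomodularity says that for every \<open>v : e \<rightarrow> b\<close> the change-of-base functor from points
  over \<open>b\<close> to points over \<open>e\<close> reflects isomorphisms.  Below, \<open>f\<close> is a morphism of points from
  \<open>(p, s)\<close> to \<open>(p', s')\<close> and \<open>g\<close> is its image between the pullbacks along \<open>v\<close>; as \<open>g\<close>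
  automatically commutes with the induced sections, these are not mentioned.\<close>

definition point :: "('o, 'm) cat \<Rightarrow> 'o \<Rightarrow> 'm \<Rightarrow> 'm \<Rightarrow> bool" where
  "point C b p s \<longleftrightarrow>
     p \<in> Ar C \<and> Cod C p = b \<and> s \<in> Hom C b (Dom C p) \<and> p \<cdot>\<^bsub>C\<^esub> s = Id C b"

definition protomodular :: "('o, 'm) cat \<Rightarrow> bool" where
  "protomodular C \<longleftrightarrow>
     (\<forall>b v p s p' s' f x y x' y' g.
        v \<in> Ar C \<and> Cod C v = b \<and> point C b p s \<and> point C b p' s' \<and>
        f \<in> Hom C (Dom C p) (Dom C p') \<and> p' \<cdot>\<^bsub>C\<^esub> f = p \<and> f \<cdot>\<^bsub>C\<^esub> s = s' \<and>
        pullback C p v x y \<and> pullback C p' v x' y' \<and>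
        g \<in> Hom C (Dom C x) (Dom C x') \<and> x' \<cdot>\<^bsub>C\<^esub> g = f \<cdot>\<^bsub>C\<^esub> x \<and> y' \<cdot>\<^bsub>C\<^esub> g = y \<and>
        iso_arr C g \<longrightarrow> iso_arr C f)"

locale semi_abelian = category C for C :: "('o, 'm) cat" (structure) +
  assumes pointed: "pointed C"
    and binary_coproducts: "has_binary_coproducts C"
    and barr_exact: "barr_exact C"
    and protomodular: "protomodular C"


section \<open>Chain complexes\<close>

record ('o, 'm) chain =
  deg :: "int \<Rightarrow> 'o"
  bd :: "int \<Rightarrow> 'm"

record ('o, 'm) chain_map =
  src :: "('o, 'm) chain"
  tgt :: "('o, 'm) chain"
  cmpt :: "int \<Rightarrow> 'm"

definition chain_complex :: "('o, 'm) cat \<Rightarrow> ('o, 'm) chain \<Rightarrow> bool" where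
  "chain_complex C M \<longleftrightarrow>
     (\<forall>i. deg M i \<in> Ob C \<and> bd M i \<in> Hom C (deg M i) (deg M (i - 1))) \<and>
     (\<forall>i. zero_arr C (bd M i \<cdot>\<^bsub>C\<^esub> bd M (i + 1)))"

definition ch :: "('o, 'm) cat \<Rightarrow> (('o, 'm) chain, ('o, 'm) chain_map) cat" where
  "ch C =
     \<lparr>Ob = {M. chain_complex C M},
      Ar = {f. chain_complex C (src f) \<and> chain_complex C (tgt f) \<and>
               (\<forall>i. cmpt f i \<in> Hom C (deg (src f) i) (deg (tgt f) i)) \<and>
               (\<forall>i. bd (tgt f) i \<cdot>\<^bsub>C\<^esub> cmpt f i = cmpt f (i - 1) \<cdot>\<^bsub>C\<^esub> bd (src f) i)},
      Dom = src,
      Cod = tgt,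
      Id = (\<lambda>M. \<lparr>src = M, tgt = M, cmpt = (\<lambda>i. Id C (deg M i))\<rparr>),
      Cmp = (\<lambda>g f. \<lparr>src = src f, tgt = tgt g, cmpt = (\<lambda>i. cmpt g i \<cdot>\<^bsub>C\<^esub> cmpt f i)\<rparr>)\<rparr>"

definition proper_arr :: "('o, 'm) cat \<Rightarrow> 'm \<Rightarrow> bool" where
  "proper_arr C f \<longleftrightarrow>
     (\<forall>e m. normal_epi C e \<and> mono_arr C m \<and> Cod C e = Dom C m \<and> f = m \<cdot>\<^bsub>C\<^esub> e \<longrightarrow> normal_mono C m)"

definition proper :: "('o, 'm) cat \<Rightarrow> ('o, 'm) chain set" where
  "proper C = {M. chain_complex C M \<and> (\<forall>i. proper_arr C (bd M i))}"

definition pch :: "('o, 'm) cat \<Rightarrow> (('o, 'm) chain, ('o, 'm) chain_map) cat" where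
  "pch C = full_subcat (ch C) (proper C)"

definition short_exact_pch ::
  "('o, 'm) cat \<Rightarrow> ('o, 'm) chain_map \<Rightarrow> ('o, 'm) chain_map \<Rightarrow> bool"
where
  "short_exact_pch C k q \<longleftrightarrow>
     short_exact (ch C) k q \<and> {Dom (ch C) k, Cod (ch C) k, Cod (ch C) q} \<subseteq> proper C"


section \<open>Torsion theories\<close>

text \<open>Full subcategories are represented by their sets of objects.  The notion of short exact
  sequence is a parameter \<open>ses\<close>, since the one of \<^term>\<open>pch C\<close> is inherited from \<^term>\<open>ch C\<close>.\<close>

definition full_replete :: "('o, 'm) cat \<Rightarrow> 'o set \<Rightarrow> bool" where
  "full_replete A S \<longleftrightarrow>
     S \<subseteq> Ob A \<and> (\<forall>a\<in>S. \<forall>b\<in>Ob A. isomorphic A a b \<longrightarrow> b \<in> S)"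

definition TT1 :: "('o, 'm) cat \<Rightarrow> 'o set \<Rightarrow> 'o set \<Rightarrow> bool" where
  "TT1 A T F \<longleftrightarrow> (\<forall>t\<in>T. \<forall>x\<in>F. \<forall>f \<in> Hom A t x. zero_arr A f)"

definition TT2 :: "('o, 'm) cat \<Rightarrow> ('m \<Rightarrow> 'm \<Rightarrow> bool) \<Rightarrow> 'o set \<Rightarrow> 'o set \<Rightarrow> bool" where
  "TT2 A ses T F \<longleftrightarrow>
     (\<forall>x\<in>Ob A. \<exists>t\<in>T. \<exists>y\<in>F. \<exists>k \<in> Hom A t x. \<exists>q \<in> Hom A x y. ses k q)"

definition torsion_theory ::
  "('o, 'm) cat \<Rightarrow> ('m \<Rightarrow> 'm \<Rightarrow> bool) \<Rightarrow> 'o set \<Rightarrow> 'o set \<Rightarrow> bool"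
where
  "torsion_theory A ses T F \<longleftrightarrow>
     full_replete A T \<and> full_replete A F \<and> TT1 A T F \<and> TT2 A ses T F"


section \<open>Truncations\<close>

definition ch_le :: "('o, 'm) cat \<Rightarrow> int \<Rightarrow> ('o, 'm) chain set" where
  "ch_le C k = {M \<in> Ob (ch C). \<forall>i>k. zero_obj C (deg M i)}"

definition pch_le :: "('o, 'm) cat \<Rightarrow> int \<Rightarrow> ('o, 'm) chain set" where
  "pch_le C k = {M \<in> Ob (pch C). \<forall>i>k. zero_obj C (deg M i)}"

definition the_zero :: "('o, 'm) cat \<Rightarrow> 'o" where
  "the_zero C = (SOME z. zero_obj C z)"

definition the_zero_arr :: "('o, 'm) cat \<Rightarrow> 'o \<Rightarrow> 'o \<Rightarrow> 'm" where
  "the_zero_arr C a b = (THE f. f \<in> Hom C a b \<and> zero_arr C f)"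

text \<open>A chosen cokernel projection; its codomain is \<open>Cok(f)\<close>.\<close>

definition cok :: "('o, 'm) cat \<Rightarrow> 'm \<Rightarrow> 'm" where
  "cok C f = (SOME q. is_cokernel C f q)"

text \<open>The object part of the cotruncation functor: \<open>Cok(\<delta>\<^sub>k\<^sub>+\<^sub>1)\<close> is placed in degree \<open>k\<close>.\<close>

definition cot :: "('o, 'm) cat \<Rightarrow> int \<Rightarrow> ('o, 'm) chain \<Rightarrow> ('o, 'm) chain" where
  "cot C k M =
     (let q = cok C (bd M (k + 1));
          D = (\<lambda>i. if i < k then deg M i else if i = k then Cod C q else the_zero C)
      in \<lparr>deg = D,
          bd = (\<lambda>i. if i < k then bd M i
                    else if i = k then THE d. d \<in> Hom C (D k) (D (k - 1)) \<and> d \<cdot>\<^bsub>C\<^esub> q = bd M k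
                    else the_zero_arr C (D i) (D (i - 1)))\<rparr>)"

definition Ker_cot :: "('o, 'm) cat \<Rightarrow> int \<Rightarrow> ('o, 'm) chain set" where
  "Ker_cot C k =
     {M \<in> Ob (ch C). \<exists>Z. zero_obj (ch C) Z \<and> isomorphic (ch C) (cot C k M) Z}"

definition EP :: "('o, 'm) cat \<Rightarrow> int \<Rightarrow> ('o, 'm) chain set" where
  "EP C n =
     {M \<in> Ob (pch C). normal_epi C (bd M n) \<and> (\<forall>i<n - 1. zero_obj C (deg M i))}"

end

theory Submission
  imports Defs
begin

text \<open>For a proper complex \<open>M\<close>, factor \<open>\<delta>\<^sub>n\<close> as a normal epimorphism \<open>e\<close> followed by a normal
  monomorphism \<open>m\<close>.  The torsion part of \<open>M\<close> is \<open>\<dots> \<rightarrow> M\<^sub>n\<^sub>+\<^sub>1 \<rightarrow> M\<^sub>n \<rightarrow> Im \<delta>\<^sub>n \<rightarrow> 0\<close>, the torsion-free part is the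
  cotruncation \<open>0 \<rightarrow> Cok \<delta>\<^sub>n \<rightarrow> M\<^sub>n\<^sub>-\<^sub>2 \<rightarrow> \<dots>\<close>, and the sequence between them is exact in each degree, in
  degree \<open>n - 1\<close> because a normal monomorphism is the kernel of its cokernel.  Any map from a
  torsion to a torsion-free complex is killed in degree \<open>n - 1\<close> by the universal property of the
  cokernel and in the other degrees by vanishing.

  The categorical input is that a semi-abelian category has normal epi/mono factorizations and
  cokernels.  Both rest on one consequence of protomodularity, the joint strong epicity of a section
  and a pullback projection: it makes regular epimorphisms normal and reflexive relations
  equivalence relations, so that Barr exactness supplies cokernels.\<close>

section \<open>Zero arrows, kernels and cokernels\<close>

text \<open>Without properness the image of \<open>\<delta>\<^sub>n\<close> may fail to be normal.
  The kernel of the projection to the cokernel is then strictly larger than the image, and the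
  sequence is no longer exact in degree n - 1; this is why only TT1 is claimed for arbitrary
  complexes. For a proper complex a zero cokernel of \<open>\<delta>\<^sub>n\<close> already forces
  \<open>\<delta>\<^sub>n\<close> to be a normal epimorphism, so the torsion class takes the form
  \<open>EP\<close>. Both halves of the decomposition must again be proper. In the torsion part the
  new boundaries are zero arrows or the normal epimorphism e; in the torsion-free part the arrow
  induced on the cokernel has the same image as \<open>\<delta>\<^sub>n\<^sub>-\<^sub>1\<close>.
  Since \<open>proper_arr\<close> speaks of all normal epi/mono factorizations, this needs images to
  be unique, which follows from diagonal lifting of normal epimorphisms against monomorphisms. The
  detour through equivalence relations has its reason in regularity: it provides coequalizers of
  kernel pairs only.\<close>

lemma mem_Hom [simp]: "f \<in> Hom C a b \<longleftrightarrow> f \<in> Ar C \<and> Dom C f = a \<and> Cod C f = b"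
  by (simp add: Hom_def)

definition epi_arr :: "('o, 'm) cat \<Rightarrow> 'm \<Rightarrow> bool" where
  "epi_arr C e \<longleftrightarrow> e \<in> Ar C \<and>
     (\<forall>b. \<forall>u \<in> Hom C (Cod C e) b. \<forall>v \<in> Hom C (Cod C e) b.
        u \<cdot>\<^bsub>C\<^esub> e = v \<cdot>\<^bsub>C\<^esub> e \<longrightarrow> u = v)"

context category
begin

lemma Ob_Dom [simp]: "f \<in> Ar C \<Longrightarrow> Dom C f \<in> Ob C"
  by (rule dom_closed)

lemma Ob_Cod [simp]: "f \<in> Ar C \<Longrightarrow> Cod C f \<in> Ob C"
  by (rule cod_closed)

lemma Id_simps [simp]:
  assumes "a \<in> Ob C"
  shows "Id C a \<in> Ar C" "Dom C (Id C a) = a" "Cod C (Id C a) = a"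
  using id_closed[OF assms] by simp_all

lemma comp_simps [simp]:
  assumes "f \<in> Ar C" "g \<in> Ar C" "Dom C g = Cod C f"
  shows "g \<cdot> f \<in> Ar C" "Dom C (g \<cdot> f) = Dom C f" "Cod C (g \<cdot> f) = Cod C g"
  using comp_closed[of f "Dom C f" "Cod C f" g "Cod C g"] assms by simp_all

lemma comp_Id_left [simp]: "f \<in> Ar C \<Longrightarrow> Cod C f = b \<Longrightarrow> Id C b \<cdot> f = f"
  using id_left[of f "Dom C f" b] by simp

lemma comp_Id_right [simp]: "f \<in> Ar C \<Longrightarrow> Dom C f = a \<Longrightarrow> f \<cdot> Id C a = f"
  using id_right[of f a "Cod C f"] by simp

text \<open>Oriented to nest composites to the right. A commutativity equation then need not match
  inside a longer composite, hence the explicit regroupings in later chains, where such an equation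
  is applied by \<open>unfolding\<close> and kept apart from the typing facts.\<close>

lemma assoc [simp]:
  "f \<in> Ar C \<Longrightarrow> g \<in> Ar C \<Longrightarrow> h \<in> Ar C \<Longrightarrow> Dom C g = Cod C f \<Longrightarrow> Dom C h = Cod C g \<Longrightarrow>
    (h \<cdot> g) \<cdot> f = h \<cdot> (g \<cdot> f)"
  using comp_assoc[of f "Dom C f" "Cod C f" g "Cod C g" h "Cod C h"] by simp

lemma mono_arrD:
  assumes "mono_arr C m" "m \<cdot> u = m \<cdot> v" "u \<in> Ar C" "v \<in> Ar C" "Dom C u = Dom C v"
    "Cod C u = Dom C m" "Cod C v = Dom C m"
  shows "u = v"
  using assms unfolding mono_arr_def by (metis mem_Hom)

lemma epi_arrD:
  assumes "epi_arr C e" "u \<cdot> e = v \<cdot> e" "u \<in> Ar C" "v \<in> Ar C" "Cod C u = Cod C v"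
    "Dom C u = Cod C e" "Dom C v = Cod C e"
  shows "u = v"
  using assms unfolding epi_arr_def by (metis mem_Hom)

lemma mono_arr_in: "mono_arr C m \<Longrightarrow> m \<in> Ar C"
  by (simp add: mono_arr_def)

lemma epi_arr_in: "epi_arr C m \<Longrightarrow> m \<in> Ar C"
  by (simp add: epi_arr_def)

lemma iso_arrE:
  assumes "iso_arr C f"
  obtains g where "f \<in> Ar C" "g \<in> Ar C" "Dom C g = Cod C f" "Cod C g = Dom C f"
    "g \<cdot> f = Id C (Dom C f)" "f \<cdot> g = Id C (Cod C f)"
  using assms unfolding iso_arr_def by (metis mem_Hom)

lemma iso_Id: "a \<in> Ob C \<Longrightarrow> iso_arr C (Id C a)"
  unfolding iso_arr_def by (auto intro!: bexI[of _ "Id C a"])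

lemma zero_arr_in: "zero_arr C f \<Longrightarrow> f \<in> Ar C"
  by (simp add: zero_arr_def)

lemma zero_obj_in: "zero_obj C z \<Longrightarrow> z \<in> Ob C"
  by (simp add: zero_obj_def)

lemma zero_obj_initial:
  assumes "zero_obj C z" "f \<in> Ar C" "g \<in> Ar C" "Dom C f = z" "Dom C g = z" "Cod C f = Cod C g"
  shows "f = g"
  using assms unfolding zero_obj_def by (metis Ob_Cod mem_Hom)

lemma zero_obj_terminal:
  assumes "zero_obj C z" "f \<in> Ar C" "g \<in> Ar C" "Cod C f = z" "Cod C g = z" "Dom C f = Dom C g"
  shows "f = g"
  using assms unfolding zero_obj_def by (metis Ob_Dom mem_Hom)

lemma zero_arrI:
  assumes "zero_obj C z" "g \<in> Ar C" "h \<in> Ar C" "Cod C g = z" "Dom C h = z"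
  shows "zero_arr C (h \<cdot> g)"
  unfolding zero_arr_def
proof (intro conjI exI bexI)
  show "zero_obj C z" by fact
qed (use assms in auto)

lemma zero_arrE:
  assumes "zero_arr C f"
  obtains z g h where "zero_obj C z" "g \<in> Ar C" "h \<in> Ar C" "Cod C g = z" "Dom C h = z"
    "Dom C g = Dom C f" "Cod C h = Cod C f" "h \<cdot> g = f"
  using assms unfolding zero_arr_def by (metis mem_Hom)

lemma zero_arr_to_zero:
  assumes "zero_obj C (Cod C f)" "f \<in> Ar C"
  shows "zero_arr C f"
  using zero_arrI[OF assms(1,2), of "Id C (Cod C f)"] assms by simp

lemma zero_arr_from_zero:
  assumes "zero_obj C (Dom C f)" "f \<in> Ar C"
  shows "zero_arr C f"
  using zero_arrI[OF assms(1), of "Id C (Dom C f)" f] assms by simp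

lemma zero_arr_comp_left:
  assumes "zero_arr C f" "g \<in> Ar C" "Dom C g = Cod C f"
  shows "zero_arr C (g \<cdot> f)"
proof -
  obtain z p h where f: "zero_obj C z" "p \<in> Ar C" "h \<in> Ar C" "Cod C p = z" "Dom C h = z"
    "Dom C p = Dom C f" "Cod C h = Cod C f" "h \<cdot> p = f"
    using assms(1) by (rule zero_arrE)
  then show ?thesis
    using zero_arrI[of z p "g \<cdot> h"] assms by simp
qed

lemma zero_arr_comp_right:
  assumes "zero_arr C f" "g \<in> Ar C" "Cod C g = Dom C f"
  shows "zero_arr C (f \<cdot> g)"
proof -
  obtain z p h where f: "zero_obj C z" "p \<in> Ar C" "h \<in> Ar C" "Cod C p = z" "Dom C h = z"
    "Dom C p = Dom C f" "Cod C h = Cod C f" "h \<cdot> p = f"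
    using assms(1) by (rule zero_arrE)
  then show ?thesis
    using zero_arrI[of z "p \<cdot> g" h] assms assoc[of g p h] by simp
qed

text \<open>The two factorizations may pass through different zero objects; the unique arrow
  \<open>t\<close> between these identifies them.\<close>

lemma zero_arr_unique:
  assumes "zero_arr C f" "zero_arr C g" "Dom C f = Dom C g" "Cod C f = Cod C g"
  shows "f = g"
proof -
  obtain z p h where f: "zero_obj C z" "p \<in> Ar C" "h \<in> Ar C" "Cod C p = z" "Dom C h = z"
    "Dom C p = Dom C f" "Cod C h = Cod C f" "h \<cdot> p = f"
    using assms(1) by (rule zero_arrE)
  obtain z' p' h' where g: "zero_obj C z'" "p' \<in> Ar C" "h' \<in> Ar C" "Cod C p' = z'" "Dom C h' = z'"
    "Dom C p' = Dom C g" "Cod C h' = Cod C g" "h' \<cdot> p' = g"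
    using assms(2) by (rule zero_arrE)
  obtain t where t: "t \<in> Ar C" "Dom C t = z" "Cod C t = z'"
    using f(1) g(1) unfolding zero_obj_def by (metis mem_Hom)
  have p: "p' = t \<cdot> p"
    using f g t assms by (intro zero_obj_terminal[OF g(1)]) auto
  have h: "h = h' \<cdot> t"
    using f g t assms by (intro zero_obj_initial[OF f(1)]) auto
  have "f = (h' \<cdot> t) \<cdot> p"
    using f(8) h by simp
  also have "\<dots> = h' \<cdot> p'"
    using f(2,3,4) g(3,5) t p by simp
  finally show ?thesis
    using g(8) by simp
qed

text \<open>Composition with the identity makes every arrow into or out of \<open>a\<close> zero,
  which gives uniqueness; existence comes from the zero object through which the identity
  factors.\<close>

lemma zero_obj_if_Id_zero:
  assumes "a \<in> Ob C" "zero_arr C (Id C a)"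
  shows "zero_obj C a"
proof -
  obtain z g h where z: "zero_obj C z" "g \<in> Ar C" "h \<in> Ar C" "Cod C g = z" "Dom C h = z"
    "Dom C g = a" "Cod C h = a" "h \<cdot> g = Id C a"
    using assms(2) by (rule zero_arrE) (use assms(1) in auto)
  have "(\<exists>!f. f \<in> Hom C a b) \<and> (\<exists>!f. f \<in> Hom C b a)" if b: "b \<in> Ob C" for b
  proof -
    obtain f where f: "f \<in> Hom C z b" using z(1) b unfolding zero_obj_def by blast
    obtain f' where f': "f' \<in> Hom C b z" using z(1) b unfolding zero_obj_def by blast
    have l: "zero_arr C u" if "u \<in> Hom C a b" for u
      using zero_arr_comp_left[OF assms(2), of u] that assms(1) by simp
    have r: "zero_arr C u" if "u \<in> Hom C b a" for u
      using zero_arr_comp_right[OF assms(2), of u] that assms(1) by simp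
    have "\<exists>!f. f \<in> Hom C a b"
    proof (rule ex1I[of _ "f \<cdot> g"])
      show fg: "f \<cdot> g \<in> Hom C a b" using f z by simp
      show "u = f \<cdot> g" if "u \<in> Hom C a b" for u
        using zero_arr_unique[OF l l, of u "f \<cdot> g"] that fg by simp
    qed
    moreover have "\<exists>!f. f \<in> Hom C b a"
    proof (rule ex1I[of _ "h \<cdot> f'"])
      show fg: "h \<cdot> f' \<in> Hom C b a" using f' z by simp
      show "u = h \<cdot> f'" if "u \<in> Hom C b a" for u
        using zero_arr_unique[OF r r, of u "h \<cdot> f'"] that fg by simp
    qed
    ultimately show ?thesis by blast
  qed
  then show ?thesis using assms(1) by (simp add: zero_obj_def)
qed

lemma zero_obj_iso:
  assumes "zero_obj C a" "iso_arr C f" "Dom C f = a"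
  shows "zero_obj C (Cod C f)"
proof -
  obtain g where g: "f \<in> Ar C" "g \<in> Ar C" "Dom C g = Cod C f" "Cod C g = Dom C f"
    "g \<cdot> f = Id C (Dom C f)" "f \<cdot> g = Id C (Cod C f)"
    using assms(2) by (rule iso_arrE)
  have "zero_arr C (f \<cdot> g)"
    using g assms by (intro zero_arrI) auto
  then show ?thesis using g by (intro zero_obj_if_Id_zero) auto
qed

text \<open>Monicity replaces the uniqueness clause of \<open>is_kernel\<close>, so a verification
  only has to produce factorizations; \<open>is_cokernelI\<close> is dual.\<close>

lemma is_kernelI:
  assumes "f \<in> Ar C" "mono_arr C k" "Cod C k = Dom C f" "zero_arr C (f \<cdot> k)"
    and "\<And>u. u \<in> Ar C \<Longrightarrow> Cod C u = Dom C f \<Longrightarrow> zero_arr C (f \<cdot> u) \<Longrightarrow>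
      \<exists>h. h \<in> Ar C \<and> Dom C h = Dom C u \<and> Cod C h = Dom C k \<and> k \<cdot> h = u"
  shows "is_kernel C f k"
  unfolding is_kernel_def
proof (intro conjI allI ballI impI)
  fix a u assume u: "u \<in> Hom C a (Dom C f)" "zero_arr C (f \<cdot> u)"
  then obtain h where h: "h \<in> Ar C" "Dom C h = a" "Cod C h = Dom C k" "k \<cdot> h = u"
    using assms(5)[of u] by auto
  then show "\<exists>!h. h \<in> Hom C a (Dom C k) \<and> k \<cdot> h = u"
    by (intro ex1I[of _ h]) (auto intro: mono_arrD[OF assms(2)])
qed (use assms mono_arr_in in auto)

lemma is_cokernelI:
  assumes "f \<in> Ar C" "epi_arr C q" "Dom C q = Cod C f" "zero_arr C (q \<cdot> f)"
    and "\<And>u. u \<in> Ar C \<Longrightarrow> Dom C u = Cod C f \<Longrightarrow> zero_arr C (u \<cdot> f) \<Longrightarrow>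
      \<exists>h. h \<in> Ar C \<and> Dom C h = Cod C q \<and> Cod C h = Cod C u \<and> h \<cdot> q = u"
  shows "is_cokernel C f q"
  unfolding is_cokernel_def
proof (intro conjI allI ballI impI)
  fix b u assume u: "u \<in> Hom C (Cod C f) b" "zero_arr C (u \<cdot> f)"
  then obtain h where h: "h \<in> Ar C" "Dom C h = Cod C q" "Cod C h = b" "h \<cdot> q = u"
    using assms(5)[of u] by auto
  then show "\<exists>!h. h \<in> Hom C (Cod C q) b \<and> h \<cdot> q = u"
    by (intro ex1I[of _ h]) (auto intro: epi_arrD[OF assms(2)])
qed (use assms epi_arr_in in auto)

lemma is_kernelD:
  assumes "is_kernel C f k"
  shows "f \<in> Ar C" "k \<in> Ar C" "Cod C k = Dom C f" "zero_arr C (f \<cdot> k)"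
  using assms unfolding is_kernel_def by auto

lemma is_cokernelD:
  assumes "is_cokernel C f q"
  shows "f \<in> Ar C" "q \<in> Ar C" "Dom C q = Cod C f" "zero_arr C (q \<cdot> f)"
  using assms unfolding is_cokernel_def by auto

lemma is_kernelE:
  assumes "is_kernel C f k" "zero_arr C (f \<cdot> u)" "u \<in> Ar C" "Cod C u = Dom C f"
  obtains h where "h \<in> Ar C" "Dom C h = Dom C u" "Cod C h = Dom C k" "k \<cdot> h = u"
  using assms unfolding is_kernel_def by (metis mem_Hom)

lemma is_cokernelE:
  assumes "is_cokernel C f q" "zero_arr C (u \<cdot> f)" "u \<in> Ar C" "Dom C u = Cod C f"
  obtains h where "h \<in> Ar C" "Dom C h = Cod C q" "Cod C h = Cod C u" "h \<cdot> q = u"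
  using assms unfolding is_cokernel_def by (metis mem_Hom)

lemma is_kernel_mono:
  assumes "is_kernel C f k"
  shows "mono_arr C k"
  unfolding mono_arr_def
proof (intro conjI allI ballI impI)
  note k = is_kernelD[OF assms]
  show "k \<in> Ar C" by fact
  fix a u v assume *: "u \<in> Hom C a (Dom C k)" "v \<in> Hom C a (Dom C k)" "k \<cdot> u = k \<cdot> v"
  have "zero_arr C ((f \<cdot> k) \<cdot> u)"
    using k * by (intro zero_arr_comp_right[OF k(4)]) auto
  then have "zero_arr C (f \<cdot> (k \<cdot> u))" using k * by simp
  then have "\<exists>!h. h \<in> Hom C a (Dom C k) \<and> k \<cdot> h = k \<cdot> u"
    using assms * k unfolding is_kernel_def by simp
  then show "u = v" using * by metis
qed

lemma is_cokernel_epi: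
  assumes "is_cokernel C f q"
  shows "epi_arr C q"
  unfolding epi_arr_def
proof (intro conjI allI ballI impI)
  note q = is_cokernelD[OF assms]
  show "q \<in> Ar C" by fact
  fix b u v assume *: "u \<in> Hom C (Cod C q) b" "v \<in> Hom C (Cod C q) b" "u \<cdot> q = v \<cdot> q"
  have "zero_arr C (u \<cdot> (q \<cdot> f))"
    using q * by (intro zero_arr_comp_left[OF q(4)]) auto
  then have "zero_arr C ((u \<cdot> q) \<cdot> f)" using q *(1) by simp
  then have "\<exists>!h. h \<in> Hom C (Cod C q) b \<and> h \<cdot> q = u \<cdot> q"
    using assms * q unfolding is_cokernel_def by simp
  then show "u = v" using * by metis
qed

lemma normal_epi_epi: "normal_epi C e \<Longrightarrow> epi_arr C e"
  by (auto simp: normal_epi_def is_cokernel_epi)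

lemma normal_mono_mono: "normal_mono C m \<Longrightarrow> mono_arr C m"
  by (auto simp: normal_mono_def is_kernel_mono)

text \<open>This and the next three lemmas treat the degenerate exact sequences a = a -> 0 and 0 ->
  a = a, which the torsion decomposition has in every degree except n - 1.\<close>

lemma is_kernel_Id:
  assumes "q \<in> Ar C" "zero_obj C (Cod C q)"
  shows "is_kernel C q (Id C (Dom C q))"
proof (rule is_kernelI)
  show "mono_arr C (Id C (Dom C q))" using assms by (auto simp: mono_arr_def)
  show "zero_arr C (q \<cdot> Id C (Dom C q))" using assms by (auto intro: zero_arr_to_zero)
qed (use assms in auto)

lemma is_cokernel_of_Id:
  assumes "q \<in> Ar C" "zero_obj C (Cod C q)" "zero_arr C q"
  shows "is_cokernel C (Id C (Dom C q)) q"
proof -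
  obtain s where s: "s \<in> Ar C" "Dom C s = Cod C q" "Cod C s = Dom C q"
    using assms unfolding zero_obj_def by (metis Ob_Dom mem_Hom)
  show ?thesis
  proof (rule is_cokernelI)
    show "epi_arr C q"
      using assms by (auto simp: epi_arr_def intro: zero_obj_initial)
    fix u assume u: "u \<in> Ar C" "Dom C u = Cod C (Id C (Dom C q))" "zero_arr C (u \<cdot> Id C (Dom C q))"
    then have "zero_arr C u" using assms by simp
    moreover have "zero_arr C ((u \<cdot> s) \<cdot> q)"
      using assms u s by (intro zero_arr_comp_left) auto
    ultimately have "(u \<cdot> s) \<cdot> q = u"
      using u assms s by (intro zero_arr_unique) auto
    then show "\<exists>h. h \<in> Ar C \<and> Dom C h = Cod C q \<and> Cod C h = Cod C u \<and> h \<cdot> q = u"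
      using s u assms by (intro exI[of _ "u \<cdot> s"]) auto
  qed (use assms in auto)
qed

lemma is_kernel_of_Id:
  assumes "k \<in> Ar C" "zero_obj C (Dom C k)"
  shows "is_kernel C (Id C (Cod C k)) k"
proof -
  obtain s where s: "s \<in> Ar C" "Dom C s = Cod C k" "Cod C s = Dom C k"
    using assms unfolding zero_obj_def by (metis Ob_Cod mem_Hom)
  have k: "zero_arr C k" using assms by (intro zero_arr_from_zero)
  show ?thesis
  proof (rule is_kernelI)
    show "mono_arr C k"
      using assms by (auto simp: mono_arr_def intro: zero_obj_terminal)
    fix u assume u: "u \<in> Ar C" "Cod C u = Dom C (Id C (Cod C k))" "zero_arr C (Id C (Cod C k) \<cdot> u)"
    then have "zero_arr C u" using assms by simp
    moreover have "zero_arr C (k \<cdot> (s \<cdot> u))"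
      using assms u s k by (intro zero_arr_comp_right) auto
    ultimately have "k \<cdot> (s \<cdot> u) = u"
      using u assms s by (intro zero_arr_unique) auto
    then show "\<exists>h. h \<in> Ar C \<and> Dom C h = Dom C u \<and> Cod C h = Dom C k \<and> k \<cdot> h = u"
      using s u assms by (intro exI[of _ "s \<cdot> u"]) auto
  qed (use assms k in auto)
qed

lemma is_cokernel_Id:
  assumes "k \<in> Ar C" "zero_obj C (Dom C k)"
  shows "is_cokernel C k (Id C (Cod C k))"
proof (rule is_cokernelI)
  show "epi_arr C (Id C (Cod C k))" using assms by (auto simp: epi_arr_def)
  show "zero_arr C (Id C (Cod C k) \<cdot> k)" using assms by (auto intro: zero_arr_from_zero)
qed (use assms in auto)

end

section \<open>Finite limits and image factorizations\<close>

context category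
begin

section \<open>Pullbacks, coequalizers and equalizers\<close>

lemma pullbackD:
  assumes "pullback C f g p q"
  shows "f \<in> Ar C" "g \<in> Ar C" "Cod C f = Cod C g" "p \<in> Ar C" "q \<in> Ar C" "Dom C q = Dom C p"
    "Cod C q = Dom C g" "Cod C p = Dom C f" "f \<cdot> p = g \<cdot> q"
  using assms unfolding pullback_def by auto

lemma pullbackE:
  assumes "pullback C f g p q" "f \<cdot> u = g \<cdot> v" "u \<in> Ar C" "v \<in> Ar C" "Dom C u = Dom C v"
    "Cod C u = Dom C f" "Cod C v = Dom C g"
  obtains h where "h \<in> Ar C" "Dom C h = Dom C v" "Cod C h = Dom C p" "p \<cdot> h = u" "q \<cdot> h = v"
  using assms unfolding pullback_def by (metis mem_Hom)

lemma pullback_unique: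
  assumes "pullback C f g p q" "p \<cdot> h = p \<cdot> k" "q \<cdot> h = q \<cdot> k" "h \<in> Ar C" "k \<in> Ar C"
    "Dom C h = Dom C k" "Cod C h = Dom C p" "Cod C k = Dom C p"
  shows "h = k"
proof -
  note pb = pullbackD[OF assms(1)]
  have "f \<cdot> (p \<cdot> h) = (f \<cdot> p) \<cdot> h" using pb(1-8) assms(4-8) by simp
  also have "\<dots> = g \<cdot> (q \<cdot> h)" unfolding pb(9) using pb(1-8) assms(4-8) by simp
  finally have eq: "f \<cdot> (p \<cdot> h) = g \<cdot> (q \<cdot> h)" .
  have "p \<cdot> h \<in> Hom C (Dom C h) (Dom C f)" "q \<cdot> h \<in> Hom C (Dom C h) (Dom C g)"
    using pb(1-8) assms(4-8) by simp_all
  then have "\<exists>!x. x \<in> Hom C (Dom C h) (Dom C p) \<and> p \<cdot> x = p \<cdot> h \<and> q \<cdot> x = q \<cdot> h"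
    using assms(1) eq unfolding pullback_def by blast
  moreover have "h \<in> Hom C (Dom C h) (Dom C p)" "k \<in> Hom C (Dom C h) (Dom C p)"
    using assms by simp_all
  ultimately show ?thesis using assms(2,3) by metis
qed

lemma pullbackI:
  assumes "f \<in> Ar C" "g \<in> Ar C" "Cod C f = Cod C g" "p \<in> Ar C" "q \<in> Ar C" "Dom C q = Dom C p"
    "Cod C q = Dom C g" "Cod C p = Dom C f" "f \<cdot> p = g \<cdot> q"
    and ex: "\<And>u v. u \<in> Ar C \<Longrightarrow> v \<in> Ar C \<Longrightarrow> Dom C u = Dom C v \<Longrightarrow> Cod C u = Dom C f \<Longrightarrow>
      Cod C v = Dom C g \<Longrightarrow> f \<cdot> u = g \<cdot> v \<Longrightarrow>
      \<exists>h. h \<in> Ar C \<and> Dom C h = Dom C v \<and> Cod C h = Dom C p \<and> p \<cdot> h = u \<and> q \<cdot> h = v"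
    and un: "\<And>h k. h \<in> Ar C \<Longrightarrow> k \<in> Ar C \<Longrightarrow> Dom C h = Dom C k \<Longrightarrow> Cod C h = Dom C p \<Longrightarrow>
      Cod C k = Dom C p \<Longrightarrow> p \<cdot> h = p \<cdot> k \<Longrightarrow> q \<cdot> h = q \<cdot> k \<Longrightarrow> h = k"
  shows "pullback C f g p q"
  unfolding pullback_def
proof (intro conjI allI ballI impI)
  fix a u v assume uv: "u \<in> Hom C a (Dom C f)" "v \<in> Hom C a (Dom C g)" "f \<cdot> u = g \<cdot> v"
  then obtain h where h: "h \<in> Ar C" "Dom C h = a" "Cod C h = Dom C p" "p \<cdot> h = u" "q \<cdot> h = v"
    using ex[of u v] by auto
  then show "\<exists>!h. h \<in> Hom C a (Dom C p) \<and> p \<cdot> h = u \<and> q \<cdot> h = v"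
    by (intro ex1I[of _ h]) (auto intro: un)
qed (use assms(1-9) in auto)

lemma coequalizerD:
  assumes "coequalizer C f g q"
  shows "f \<in> Ar C" "g \<in> Ar C" "Dom C g = Dom C f" "Cod C g = Cod C f" "q \<in> Ar C"
    "Dom C q = Cod C f" "q \<cdot> f = q \<cdot> g"
  using assms unfolding coequalizer_def by auto

lemma coequalizerE:
  assumes "coequalizer C f g q" "u \<cdot> f = u \<cdot> g" "u \<in> Ar C" "Dom C u = Cod C f"
  obtains h where "h \<in> Ar C" "Dom C h = Cod C q" "Cod C h = Cod C u" "h \<cdot> q = u"
  using assms unfolding coequalizer_def by (metis mem_Hom)

lemma coequalizer_epi:
  assumes "coequalizer C f g q"
  shows "epi_arr C q"
  unfolding epi_arr_def
proof (intro conjI allI ballI impI)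
  note q = coequalizerD[OF assms]
  show "q \<in> Ar C" by fact
  fix b u v assume *: "u \<in> Hom C (Cod C q) b" "v \<in> Hom C (Cod C q) b" "u \<cdot> q = v \<cdot> q"
  have "(u \<cdot> q) \<cdot> f = u \<cdot> (q \<cdot> f)" using q(1-6) *(1,2) by simp
  also have "\<dots> = (u \<cdot> q) \<cdot> g" unfolding q(7) using q(1-6) *(1,2) by simp
  finally have "\<exists>!h. h \<in> Hom C (Cod C q) b \<and> h \<cdot> q = u \<cdot> q"
    using assms *(1,2) q(1-6) unfolding coequalizer_def by simp
  then show "u = v" using * by metis
qed

lemma regular_epi_epi: "regular_epi C e \<Longrightarrow> epi_arr C e"
  by (auto simp: regular_epi_def coequalizer_epi)

lemma epi_comp:
  assumes "epi_arr C e" "epi_arr C e'" "Dom C e' = Cod C e"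
  shows "epi_arr C (e' \<cdot> e)"
  unfolding epi_arr_def
proof (intro conjI allI ballI impI)
  note in_Ar = epi_arr_in[OF assms(1)] epi_arr_in[OF assms(2)]
  show "e' \<cdot> e \<in> Ar C" using in_Ar assms(3) by simp
  fix b u v assume *: "u \<in> Hom C (Cod C (e' \<cdot> e)) b" "v \<in> Hom C (Cod C (e' \<cdot> e)) b"
    "u \<cdot> (e' \<cdot> e) = v \<cdot> (e' \<cdot> e)"
  have "u \<cdot> e' = v \<cdot> e'"
    by (rule epi_arrD[OF assms(1)]) (use * in_Ar assms(3) in auto)
  then show "u = v"
    by (rule epi_arrD[OF assms(2)]) (use * in_Ar assms(3) in auto)
qed

lemma finitely_complete_pullback:
  assumes "finitely_complete C" "f \<in> Ar C" "g \<in> Ar C" "Cod C f = Cod C g"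
  obtains p q where "pullback C f g p q"
proof -
  \<comment> \<open>A cospan: vertices 0 and 1 carry the two domains, vertex 2 the common codomain.
    Edge \<open>e\<close> starts at vertex \<open>e\<close>, so \<open>id\<close> serves as source
    map.\<close>
  define V E :: "nat set" where "V = {0, 1, 2}" and "E = {0, 1}"
  define D where "D v = (if v = 0 then Dom C f else if v = 1 then Dom C g else Cod C f)" for v :: nat
  define d where "d e = (if e = 0 then f else g)" for e :: nat
  have fin: "finite V" "finite E" by (simp_all add: V_def E_def)
  have "diagram C V E id (\<lambda>_. 2) D d"
    using assms by (auto simp: diagram_def V_def E_def D_def d_def)
  then obtain a p where lim: "limit_cone C V E id (\<lambda>_. 2) D d a p"
    using assms(1) fin unfolding finitely_complete_def by blast
  then have "cone C V E id (\<lambda>_. 2) D d a p"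
    by (simp add: limit_cone_def)
  then have p: "a \<in> Ob C" "p 0 \<in> Hom C a (Dom C f)" "p 1 \<in> Hom C a (Dom C g)"
    "f \<cdot> p 0 = p 2" "g \<cdot> p 1 = p 2"
    by (auto simp: cone_def V_def E_def D_def d_def)
  have "pullback C f g (p 0) (p 1)"
    unfolding pullback_def
  proof (intro conjI allI ballI impI)
    fix b u v assume uv: "u \<in> Hom C b (Dom C f)" "v \<in> Hom C b (Dom C g)" "f \<cdot> u = g \<cdot> v"
    define w where "w i = (if i = 0 then u else if i = 1 then v else f \<cdot> u)" for i :: nat
    have "cone C V E id (\<lambda>_. 2) D d b w"
      using uv assms(2-4) by (auto simp: cone_def V_def E_def D_def d_def w_def)
    then have "\<exists>!h. h \<in> Hom C b a \<and> (\<forall>i\<in>V. p i \<cdot> h = w i)"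
      using lim by (simp add: limit_cone_def)
    \<comment> \<open>The leg at vertex 2 is \<open>f \<cdot> p 0\<close>, so compatibility with it
      follows from compatibility with \<open>p 0\<close>.\<close>
    moreover have "h \<in> Hom C b a \<and> (\<forall>i\<in>V. p i \<cdot> h = w i) \<longleftrightarrow>
      h \<in> Hom C b (Dom C (p 0)) \<and> p 0 \<cdot> h = u \<and> p 1 \<cdot> h = v" for h
      using assoc[of h "p 0" f] p(2,4) assms(2-4) by (auto simp: V_def w_def)
    ultimately show "\<exists>!h. h \<in> Hom C b (Dom C (p 0)) \<and> p 0 \<cdot> h = u \<and> p 1 \<cdot> h = v"
      by simp
  qed (use assms p in auto)
  then show thesis by (rule that)
qed

lemma finitely_complete_equalizer:
  assumes "finitely_complete C" "f \<in> Ar C" "g \<in> Ar C" "Dom C f = Dom C g" "Cod C f = Cod C g"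
  obtains j where "mono_arr C j" "Cod C j = Dom C f" "f \<cdot> j = g \<cdot> j"
    "\<And>u. u \<in> Ar C \<Longrightarrow> Cod C u = Dom C f \<Longrightarrow> f \<cdot> u = g \<cdot> u \<Longrightarrow>
      \<exists>h. h \<in> Ar C \<and> Dom C h = Dom C u \<and> Cod C h = Dom C j \<and> j \<cdot> h = u"
proof -
  \<comment> \<open>Two parallel edges from vertex 0 to vertex 1.\<close>
  define V E :: "nat set" where "V = {0, 1}" and "E = {0, 1}"
  define D where "D v = (if v = 0 then Dom C f else Cod C f)" for v :: nat
  define d where "d e = (if e = 0 then f else g)" for e :: nat
  have fin: "finite V" "finite E" by (simp_all add: V_def E_def)
  have "diagram C V E (\<lambda>_. 0) (\<lambda>_. 1) D d"
    using assms by (auto simp: diagram_def V_def E_def D_def d_def)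
  then obtain a p where lim: "limit_cone C V E (\<lambda>_. 0) (\<lambda>_. 1) D d a p"
    using assms(1) fin unfolding finitely_complete_def by blast
  then have "cone C V E (\<lambda>_. 0) (\<lambda>_. 1) D d a p"
    by (simp add: limit_cone_def)
  then have p: "a \<in> Ob C" "p 0 \<in> Hom C a (Dom C f)" "f \<cdot> p 0 = p 1" "g \<cdot> p 0 = p 1"
    by (auto simp: cone_def V_def E_def D_def d_def)
  have ex1: "\<exists>!h. h \<in> Hom C (Dom C u) a \<and> p 0 \<cdot> h = u"
    if u: "u \<in> Ar C" "Cod C u = Dom C f" "f \<cdot> u = g \<cdot> u" for u
  proof -
    define w where "w i = (if i = 0 then u else f \<cdot> u)" for i :: nat
    have "cone C V E (\<lambda>_. 0) (\<lambda>_. 1) D d (Dom C u) w"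
      using u assms(2-5) by (auto simp: cone_def V_def E_def D_def d_def w_def)
    then have "\<exists>!h. h \<in> Hom C (Dom C u) a \<and> (\<forall>i\<in>V. p i \<cdot> h = w i)"
      using lim by (simp add: limit_cone_def)
    moreover have "h \<in> Hom C (Dom C u) a \<and> (\<forall>i\<in>V. p i \<cdot> h = w i) \<longleftrightarrow>
      h \<in> Hom C (Dom C u) a \<and> p 0 \<cdot> h = u" for h
      using assoc[of h "p 0" f] p(2,3) assms(2-5) by (auto simp: V_def w_def)
    ultimately show ?thesis by simp
  qed
  have "mono_arr C (p 0)"
    unfolding mono_arr_def
  proof (intro conjI allI ballI impI)
    fix b u v assume uv: "u \<in> Hom C b (Dom C (p 0))" "v \<in> Hom C b (Dom C (p 0))" "p 0 \<cdot> u = p 0 \<cdot> v"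
    have "f \<cdot> (p 0 \<cdot> u) = g \<cdot> (p 0 \<cdot> u)"
      using uv p assms assoc[of u "p 0" f] assoc[of u "p 0" g] by simp
    then have "\<exists>!h. h \<in> Hom C (Dom C (p 0 \<cdot> u)) a \<and> p 0 \<cdot> h = p 0 \<cdot> u"
      using uv p by (intro ex1) auto
    then show "u = v" using uv p by (metis comp_simps(2) mem_Hom)
  qed (use p in auto)
  then show thesis
    using that[of "p 0"] ex1 p by (metis mem_Hom)
qed

section \<open>Image factorization in a regular category\<close>

lemma regular_cat_coequalizer:
  assumes "regular_cat C" "pullback C f f r1 r2"
  obtains q where "coequalizer C r1 r2 q"
  using assms unfolding regular_cat_def by blast

text \<open>\<open>e\<close> is the coequalizer of the kernel pair of \<open>f\<close>. Two arrows
  identified by \<open>m\<close> lift, on a common cover, to the domain of \<open>f\<close>; the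
  lifts agree under \<open>f\<close>, so they factor through the kernel pair and are identified by
  \<open>e\<close>.\<close>

lemma regular_factorization:
  assumes "regular_cat C" "f \<in> Ar C"
  obtains e m where "regular_epi C e" "mono_arr C m" "e \<in> Ar C" "m \<in> Ar C" "Dom C e = Dom C f"
    "Cod C m = Cod C f" "Dom C m = Cod C e" "m \<cdot> e = f"
proof -
  have fc: "finitely_complete C" using assms by (simp add: regular_cat_def)
  obtain r1 r2 where r: "pullback C f f r1 r2"
    by (rule finitely_complete_pullback[OF fc assms(2,2)]) auto
  note rD = pullbackD[OF r]
  obtain e where e: "coequalizer C r1 r2 e"
    using assms(1) r by (rule regular_cat_coequalizer)
  note eD = coequalizerD[OF e]
  have re: "regular_epi C e" using e by (auto simp: regular_epi_def)
  obtain m where m: "m \<in> Ar C" "Dom C m = Cod C e" "Cod C m = Cod C f" "m \<cdot> e = f"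
    by (rule coequalizerE[OF e, of f]) (use rD in auto)
  have "mono_arr C m"
    unfolding mono_arr_def
  proof (intro conjI allI ballI impI)
    fix b u v assume uv: "u \<in> Hom C b (Dom C m)" "v \<in> Hom C b (Dom C m)" "m \<cdot> u = m \<cdot> v"
    \<comment> \<open>\<open>p1\<close> and \<open>p2\<close> are epimorphisms because regular
      epimorphisms are stable under pullback; over \<open>p1 \<cdot> p2\<close> the lifts of
      \<open>u\<close> and \<open>v\<close> along \<open>e\<close> are \<open>x \<cdot> p2\<close>
      and \<open>y\<close>.\<close>
    obtain x p1 where p1: "pullback C e u x p1"
      by (rule finitely_complete_pullback[OF fc, of e u]) (use uv m eD in auto)
    note p1D = pullbackD[OF p1]
    obtain y p2 where p2: "pullback C e (v \<cdot> p1) y p2"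
      by (rule finitely_complete_pullback[OF fc, of e "v \<cdot> p1"]) (use uv m eD p1D in auto)
    note p2D = pullbackD[OF p2]
    have "epi_arr C p1" "epi_arr C p2"
      using assms(1) re p1 p2 unfolding regular_cat_def by (blast intro: regular_epi_epi)+
    then have epi: "epi_arr C (p1 \<cdot> p2)"
      using p1D p2D uv by (intro epi_comp) auto
    have "f \<cdot> (x \<cdot> p2) = m \<cdot> ((e \<cdot> x) \<cdot> p2)"
      unfolding m(4)[symmetric] using m(1-3) eD(1-6) p1D(1-8) p2D(1-8) uv(1,2) by simp
    also have "\<dots> = (m \<cdot> u) \<cdot> (p1 \<cdot> p2)"
      unfolding p1D(9) using m(1-3) eD(1-6) p1D(1-8) p2D(1-8) uv(1,2) by simp
    also have "\<dots> = m \<cdot> ((v \<cdot> p1) \<cdot> p2)"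
      unfolding uv(3) using m(1-3) eD(1-6) p1D(1-8) p2D(1-8) uv(1,2) by simp
    also have "\<dots> = f \<cdot> y"
      unfolding p2D(9)[symmetric] m(4)[symmetric]
      using m(1-3) eD(1-6) p1D(1-8) p2D(1-8) uv(1,2) by simp
    finally obtain h where h: "h \<in> Ar C" "Dom C h = Dom C y" "Cod C h = Dom C r1"
      "r1 \<cdot> h = x \<cdot> p2" "r2 \<cdot> h = y"
      by (rule pullbackE[OF r]) (use eD(1-6) p1D(1-8) p2D(1-8) rD(1-8) uv(1,2) in auto)
    have "u \<cdot> (p1 \<cdot> p2) = (e \<cdot> x) \<cdot> p2"
      unfolding p1D(9) using eD(1-6) p1D(1-8) p2D(1-8) uv(1,2) by simp
    also have "\<dots> = (e \<cdot> r1) \<cdot> h"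
      using h eD(1-6) p1D(1-8) p2D(1-8) uv(1,2) rD(1-8) by simp
    also have "\<dots> = e \<cdot> (r2 \<cdot> h)"
      unfolding eD(7) using h(1-3) eD(1-6) uv(1,2) rD(1-8) by simp
    also have "\<dots> = v \<cdot> (p1 \<cdot> p2)"
      unfolding h(5) p2D(9) using p1D(1-8) p2D(1-8) uv(1,2) by simp
    finally show "u = v"
      by (rule epi_arrD[OF epi]) (use p1D(1-8) p2D(1-8) uv(1,2) in auto)
  qed (use m in auto)
  then show thesis
    using that[OF re _ eD(5) m(1)] m eD(6) rD(8) by simp
qed

text \<open>The pair \<open>f\<close>, \<open>g\<close> that has \<open>q\<close> as coequalizer
  factors through the kernel pair, so \<open>q\<close> is the coequalizer of its kernel pair as
  well.\<close>

lemma regular_epi_kernel_pair: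
  assumes "regular_epi C q" "pullback C q q r1 r2" "u \<cdot> r1 = u \<cdot> r2" "u \<in> Ar C" "Dom C u = Dom C q"
  obtains h where "h \<in> Ar C" "Dom C h = Cod C q" "Cod C h = Cod C u" "h \<cdot> q = u"
proof -
  obtain f g where fg: "coequalizer C f g q" using assms(1) by (auto simp: regular_epi_def)
  note qD = coequalizerD[OF fg]
  note rD = pullbackD[OF assms(2)]
  obtain t where t: "t \<in> Ar C" "Dom C t = Dom C g" "Cod C t = Dom C r1" "r1 \<cdot> t = f" "r2 \<cdot> t = g"
    by (rule pullbackE[OF assms(2), of f g]) (use qD in auto)
  have "u \<cdot> f = (u \<cdot> r1) \<cdot> t"
    unfolding t(4)[symmetric] using assms(4,5) rD(1-8) t(1-3) by simp
  also have "\<dots> = u \<cdot> g"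
    unfolding assms(3) t(5)[symmetric] using assms(4,5) rD(1-8) t(1-3) by simp
  finally show thesis
    by (rule coequalizerE[OF fg]) (use assms(4,5) qD that in auto)
qed

section \<open>Protomodularity\<close>

text \<open>View \<open>j\<close> as a morphism of points. Since \<open>x\<close> factors through
  the monomorphism \<open>j\<close>, the object \<open>Dom C x\<close> is a pullback along
  \<open>v\<close> of both \<open>p\<close> and \<open>p \<cdot> j\<close>, with the identity as
  comparison; reflection of isomorphisms makes \<open>j\<close> invertible. In other words, no
  proper subobject contains both \<open>s\<close> and \<open>x\<close>.\<close>

lemma protomodular_jointly_strong_epi:
  assumes "protomodular C" "point C b p s" "pullback C p v x y" "mono_arr C j" "Cod C j = Dom C p"
    and "s' \<in> Ar C" "Cod C s' = Dom C j" "Dom C s' = Dom C s" "j \<cdot> s' = s"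
    and "x' \<in> Ar C" "Cod C x' = Dom C j" "Dom C x' = Dom C x" "j \<cdot> x' = x"
  shows "iso_arr C j"
proof -
  note pb = pullbackD[OF assms(3)]
  have j: "j \<in> Ar C" using assms(4) by (rule mono_arr_in)
  have ps: "p \<in> Ar C" "Cod C p = b" "s \<in> Ar C" "Dom C s = b" "Cod C s = Dom C p" "p \<cdot> s = Id C b"
    using assms(2) by (auto simp: point_def)
  have pt: "point C b (p \<cdot> j) s'"
    using ps j assms(5-9) by (simp add: point_def)
  have pb': "pullback C (p \<cdot> j) v x' y"
  proof (rule pullbackI)
    show "(p \<cdot> j) \<cdot> x' = v \<cdot> y"
      using pb ps(1-5) j assms(5,10-13) by simp
    show "\<exists>h. h \<in> Ar C \<and> Dom C h = Dom C w \<and> Cod C h = Dom C x' \<and> x' \<cdot> h = u \<and> y \<cdot> h = w"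
      if u: "u \<in> Ar C" "w \<in> Ar C" "Dom C u = Dom C w" "Cod C u = Dom C (p \<cdot> j)" "Cod C w = Dom C v"
        "(p \<cdot> j) \<cdot> u = v \<cdot> w" for u w
    proof -
      obtain h where h: "h \<in> Ar C" "Dom C h = Dom C w" "Cod C h = Dom C x" "x \<cdot> h = j \<cdot> u" "y \<cdot> h = w"
        by (rule pullbackE[OF assms(3), of "j \<cdot> u" w]) (use u ps j assms(5) in auto)
      have "j \<cdot> (x' \<cdot> h) = j \<cdot> u"
        using h(1-3) assoc[of h x' j] unfolding h(4)[symmetric] assms(13)[symmetric]
        using j assms(5,10-12) by simp
      then have "x' \<cdot> h = u"
        by (rule mono_arrD[OF assms(4)]) (use u h(1-3) j ps(1-5) assms(5,10-12) in auto)
      then show ?thesis using h assms(12) by auto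
    qed
    show "h = k" if hk: "h \<in> Ar C" "k \<in> Ar C" "Dom C h = Dom C k" "Cod C h = Dom C x'"
      "Cod C k = Dom C x'" "x' \<cdot> h = x' \<cdot> k" "y \<cdot> h = y \<cdot> k" for h k
    proof (rule pullback_unique[OF assms(3)])
      have "(j \<cdot> x') \<cdot> h = (j \<cdot> x') \<cdot> k"
        using hk j assms(10,11) by simp
      then show "x \<cdot> h = x \<cdot> k" by (simp only: assms(13))
    qed (use hk assms(12) in auto)
  qed (use pb ps j assms in auto)
  show ?thesis
    using assms(1)[unfolded protomodular_def, rule_format,
      of v b "p \<cdot> j" s' p s j x' y x y "Id C (Dom C x)"]
      pt pb' assms(2,3) pb ps j assms(4-13) by (auto simp: iso_Id)
qed

end

section \<open>Kernels and cokernels in semi-abelian categories\<close>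

context category
begin

lemma iso_arr_cancel:
  assumes "iso_arr C j" "u \<cdot> j = v \<cdot> j" "u \<in> Ar C" "v \<in> Ar C" "Dom C u = Cod C j" "Dom C v = Cod C j"
  shows "u = v"
proof -
  obtain g where g: "j \<in> Ar C" "g \<in> Ar C" "Dom C g = Cod C j" "Cod C g = Dom C j"
    "g \<cdot> j = Id C (Dom C j)" "j \<cdot> g = Id C (Cod C j)"
    using assms(1) by (rule iso_arrE)
  have "(u \<cdot> j) \<cdot> g = (v \<cdot> j) \<cdot> g" using assms(2) by simp
  then show ?thesis using g assms(3-6) by simp
qed

end

context semi_abelian
begin

lemma regular: "regular_cat C"
  using barr_exact by (simp add: barr_exact_def)

lemma finitely_complete: "finitely_complete C"
  using regular by (simp add: regular_cat_def)

lemma zero_arr_exists: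
  assumes "a \<in> Ob C" "b \<in> Ob C"
  obtains f where "zero_arr C f" "f \<in> Ar C" "Dom C f = a" "Cod C f = b"
proof -
  obtain z where z: "zero_obj C z" using pointed by (auto simp: pointed_def)
  obtain g where g: "g \<in> Hom C a z" using z assms(1) by (auto simp: zero_obj_def)
  obtain h where h: "h \<in> Hom C z b" using z assms(2) unfolding zero_obj_def by blast
  show thesis using that[of "h \<cdot> g"] zero_arrI[OF z, of g h] g h by simp
qed

lemma mono_zero_cancel:
  assumes "mono_arr C m" "zero_arr C (m \<cdot> f)" "f \<in> Ar C" "Cod C f = Dom C m"
  shows "zero_arr C f"
proof -
  have m: "m \<in> Ar C" using assms(1) by (rule mono_arr_in)
  obtain o' where o: "zero_arr C o'" "o' \<in> Ar C" "Dom C o' = Dom C f" "Cod C o' = Cod C f"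
    using assms(3) by (rule_tac zero_arr_exists[of "Dom C f" "Cod C f"]) auto
  have "zero_arr C (m \<cdot> o')" using o m assms(4) by (intro zero_arr_comp_left) auto
  then have "m \<cdot> f = m \<cdot> o'" using assms o m by (intro zero_arr_unique) auto
  then have "f = o'" by (rule mono_arrD[OF assms(1)]) (use assms o in auto)
  then show ?thesis using o by simp
qed

lemma epi_zero_cancel:
  assumes "epi_arr C e" "zero_arr C (f \<cdot> e)" "f \<in> Ar C" "Dom C f = Cod C e"
  shows "zero_arr C f"
proof -
  have e: "e \<in> Ar C" using assms(1) by (rule epi_arr_in)
  obtain o' where o: "zero_arr C o'" "o' \<in> Ar C" "Dom C o' = Dom C f" "Cod C o' = Cod C f"
    using assms(3) by (rule_tac zero_arr_exists[of "Dom C f" "Cod C f"]) auto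
  have "zero_arr C (o' \<cdot> e)" using o e assms(4) by (intro zero_arr_comp_right) auto
  then have "f \<cdot> e = o' \<cdot> e" using assms o e by (intro zero_arr_unique) auto
  then have "f = o'" by (rule epi_arrD[OF assms(1)]) (use assms o in auto)
  then show ?thesis using o by simp
qed

text \<open>The kernel is obtained as the equalizer of \<open>f\<close> with the parallel zero
  arrow.\<close>

lemma kernel_exists:
  assumes "f \<in> Ar C"
  obtains k where "is_kernel C f k"
proof -
  obtain o' where o: "zero_arr C o'" "o' \<in> Ar C" "Dom C o' = Dom C f" "Cod C o' = Cod C f"
    using assms by (rule_tac zero_arr_exists[of "Dom C f" "Cod C f"]) auto
  obtain k where k: "mono_arr C k" "Cod C k = Dom C f" "f \<cdot> k = o' \<cdot> k"
    "\<And>u. u \<in> Ar C \<Longrightarrow> Cod C u = Dom C f \<Longrightarrow> f \<cdot> u = o' \<cdot> u \<Longrightarrow>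
      \<exists>h. h \<in> Ar C \<and> Dom C h = Dom C u \<and> Cod C h = Dom C k \<and> k \<cdot> h = u"
    by (rule finitely_complete_equalizer[OF finitely_complete, of f o']) (use assms o in auto)
  have "is_kernel C f k"
  proof (rule is_kernelI)
    show "zero_arr C (f \<cdot> k)"
      unfolding k(3) using o k mono_arr_in by (intro zero_arr_comp_right) auto
    fix u assume u: "u \<in> Ar C" "Cod C u = Dom C f" "zero_arr C (f \<cdot> u)"
    have "zero_arr C (o' \<cdot> u)" using o u by (intro zero_arr_comp_right) auto
    then have "f \<cdot> u = o' \<cdot> u" using u o assms by (intro zero_arr_unique) auto
    then show "\<exists>h. h \<in> Ar C \<and> Dom C h = Dom C u \<and> Cod C h = Dom C k \<and> k \<cdot> h = u"
      using u k(4) by blast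
  qed (use assms k in auto)
  then show thesis by (rule that)
qed

text \<open>The first projection of the kernel pair of \<open>q\<close> is split by the diagonal and its kernel is
  \<open>(0, ker q)\<close>; so if \<open>u\<close> kills \<open>ker q\<close>, the equalizer of \<open>u r1\<close> and \<open>u r2\<close> contains both and is
  everything.\<close>

lemma regular_epi_is_cokernel:
  assumes "regular_epi C q" "is_kernel C q k"
  shows "is_cokernel C k q"
proof (rule is_cokernelI)
  note kD = is_kernelD[OF assms(2)]
  show "epi_arr C q" using assms(1) by (rule regular_epi_epi)
  fix u assume u: "u \<in> Ar C" "Dom C u = Cod C k" "zero_arr C (u \<cdot> k)"
  obtain r1 r2 where r: "pullback C q q r1 r2"
    by (rule finitely_complete_pullback[OF finitely_complete kD(1,1)]) auto
  note rD = pullbackD[OF r]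
  obtain s where s: "s \<in> Ar C" "Dom C s = Dom C q" "Cod C s = Dom C r1"
    "r1 \<cdot> s = Id C (Dom C q)" "r2 \<cdot> s = Id C (Dom C q)"
    by (rule pullbackE[OF r, of "Id C (Dom C q)" "Id C (Dom C q)"]) (use kD in auto)
  \<comment> \<open>Base change is along the arrow \<open>v\<close> from a zero object, so
    \<open>x\<close> is a kernel of \<open>r1\<close>.\<close>
  obtain z where z: "zero_obj C z" using pointed by (auto simp: pointed_def)
  obtain v where v: "v \<in> Ar C" "Dom C v = z" "Cod C v = Dom C q"
    using z kD(1) unfolding zero_obj_def by (metis Ob_Dom mem_Hom)
  have v0: "zero_arr C v" using z v by (intro zero_arr_from_zero) auto
  obtain x y where x: "pullback C r1 v x y"
    by (rule finitely_complete_pullback[OF finitely_complete, of r1 v]) (use rD v in auto)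
  note xD = pullbackD[OF x]
  have r1x: "zero_arr C (r1 \<cdot> x)"
    unfolding xD(9) using v v0 xD by (intro zero_arr_comp_right) auto
  obtain j where j: "mono_arr C j" "Cod C j = Dom C (u \<cdot> r1)" "(u \<cdot> r1) \<cdot> j = (u \<cdot> r2) \<cdot> j"
    "\<And>w. w \<in> Ar C \<Longrightarrow> Cod C w = Dom C (u \<cdot> r1) \<Longrightarrow> (u \<cdot> r1) \<cdot> w = (u \<cdot> r2) \<cdot> w \<Longrightarrow>
      \<exists>h. h \<in> Ar C \<and> Dom C h = Dom C w \<and> Cod C h = Dom C j \<and> j \<cdot> h = w"
    by (rule finitely_complete_equalizer[OF finitely_complete, of "u \<cdot> r1" "u \<cdot> r2"])
      (use u kD rD in auto)
  obtain s' where s': "s' \<in> Ar C" "Dom C s' = Dom C s" "Cod C s' = Dom C j" "j \<cdot> s' = s"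
    using j(4)[of s] s u(1,2) kD rD(1-8) by auto
  \<comment> \<open>On the kernel of \<open>r1\<close> the first component is zero, so the second is
    killed by \<open>q\<close> and factors through \<open>k\<close>, where \<open>u\<close>
    vanishes.\<close>
  have "zero_arr C (q \<cdot> (r1 \<cdot> x))"
    using xD(1-8) rD(1-8) by (intro zero_arr_comp_left[OF r1x]) auto
  also have "q \<cdot> (r1 \<cdot> x) = (q \<cdot> r1) \<cdot> x" using xD(1-8) rD(1-8) by simp
  also have "\<dots> = q \<cdot> (r2 \<cdot> x)" unfolding rD(9) using xD(1-8) rD(1-8) by simp
  finally obtain h where h: "h \<in> Ar C" "Dom C h = Dom C x" "Cod C h = Dom C k" "k \<cdot> h = r2 \<cdot> x"
    by (rule is_kernelE[OF assms(2)]) (use xD(1-8) rD(1-8) in auto)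
  have "zero_arr C (u \<cdot> (r1 \<cdot> x))"
    using xD(1-8) rD(1-8) u(1,2) kD(1-3) by (intro zero_arr_comp_left[OF r1x]) auto
  moreover have "zero_arr C ((u \<cdot> k) \<cdot> h)"
    using h u(1,2) kD(1-3) by (intro zero_arr_comp_right[OF u(3)]) auto
  then have "zero_arr C (u \<cdot> (r2 \<cdot> x))"
    using h(1-3) u(1,2) kD(1-3) unfolding h(4)[symmetric] by simp
  ultimately have "u \<cdot> (r1 \<cdot> x) = u \<cdot> (r2 \<cdot> x)"
    using xD(1-8) rD(1-8) u(1,2) kD(1-3) by (intro zero_arr_unique) auto
  then obtain x' where x': "x' \<in> Ar C" "Dom C x' = Dom C x" "Cod C x' = Dom C j" "j \<cdot> x' = x"
    using j(4)[of x] xD(1-8) rD(1-8) u(1,2) kD(1-3) by auto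
  have "iso_arr C j"
  proof (rule protomodular_jointly_strong_epi[OF protomodular _ x j(1)])
    show "point C (Dom C q) r1 s" using rD s by (simp add: point_def)
  qed (use j s s' x' u kD rD in auto)
  then have "u \<cdot> r1 = u \<cdot> r2"
    by (rule iso_arr_cancel[OF _ j(3)]) (use j(2) u kD rD in auto)
  then show "\<exists>h. h \<in> Ar C \<and> Dom C h = Cod C q \<and> Cod C h = Cod C u \<and> h \<cdot> q = u"
    by (rule regular_epi_kernel_pair[OF assms(1) r]) (use u kD in auto)
qed (use is_kernelD[OF assms(2)] in auto)

lemma regular_epi_normal:
  assumes "regular_epi C q"
  shows "normal_epi C q"
proof -
  have "q \<in> Ar C" using assms regular_epi_epi epi_arr_in by blast
  then obtain k where "is_kernel C q k" by (rule kernel_exists)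
  then show ?thesis using regular_epi_is_cokernel[OF assms] by (auto simp: normal_epi_def)
qed

lemma normal_factorization:
  assumes "f \<in> Ar C"
  obtains e m where "normal_epi C e" "mono_arr C m" "e \<in> Ar C" "m \<in> Ar C" "Dom C e = Dom C f"
    "Cod C m = Cod C f" "Dom C m = Cod C e" "m \<cdot> e = f"
  using regular_factorization[OF regular assms] regular_epi_normal by metis

text \<open>Below \<open>P\<close> (the domain of \<open>p\<close>) is the object of triples \<open>(a, b, c)\<close> as in the hypotheses and
  \<open>p\<close> maps them to \<open>(b, c)\<close>.  The subobject \<open>j\<close> of those triples that admit a \<open>d\<close> contains the section
  \<open>(b, b, c)\<close>, with \<open>d = c\<close>, and the pullback \<open>(a, b, b)\<close>, with \<open>d = a\<close>, so it is everything.\<close>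

lemma difunctional:
  assumes r: "r1 \<in> Ar C" "r2 \<in> Ar C" "Dom C r2 = Dom C r1"
    and jointly_monic: "\<And>x y. r1 \<cdot> x = r1 \<cdot> y \<Longrightarrow> r2 \<cdot> x = r2 \<cdot> y \<Longrightarrow> x \<in> Ar C \<Longrightarrow> y \<in> Ar C \<Longrightarrow>
      Dom C x = Dom C y \<Longrightarrow> Cod C x = Dom C r1 \<Longrightarrow> Cod C y = Dom C r1 \<Longrightarrow> x = y"
    and abc: "a \<in> Ar C" "b \<in> Ar C" "c \<in> Ar C" "Cod C a = Dom C r1" "Cod C b = Dom C r1"
      "Cod C c = Dom C r1" "Dom C a = Dom C c" "Dom C b = Dom C c" "r2 \<cdot> a = r2 \<cdot> b" "r1 \<cdot> b = r1 \<cdot> c"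
  obtains d where "d \<in> Ar C" "Dom C d = Dom C c" "Cod C d = Dom C r1" "r1 \<cdot> d = r1 \<cdot> a" "r2 \<cdot> d = r2 \<cdot> c"
proof -
  note fc = finitely_complete
  let ?R = "Dom C r1"
  \<comment> \<open>\<open>y1\<close>, \<open>y2\<close> are the components \<open>b\<close>,
    \<open>c\<close> of the pairs with equal \<open>r1\<close>; the pullback that follows adds
    \<open>a\<close>, read off by \<open>x1\<close>, with the same \<open>r2\<close> as
    \<open>b\<close>.\<close>
  obtain y1 y2 where y: "pullback C r1 r1 y1 y2"
    by (rule finitely_complete_pullback[OF fc r(1,1)]) auto
  note yD = pullbackD[OF y]
  obtain p x1 where p: "pullback C (r2 \<cdot> y1) r2 p x1"
    by (rule finitely_complete_pullback[OF fc, of "r2 \<cdot> y1" r2]) (use r yD in auto)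
  note pD = pullbackD[OF p]
  \<comment> \<open>\<open>v\<close> is the diagonal, sending \<open>b\<close> to
    \<open>(b, b)\<close>; base change of \<open>p\<close> along it cuts out the triples
    \<open>(a, b, b)\<close>.\<close>
  obtain v where v: "v \<in> Ar C" "Dom C v = ?R" "Cod C v = Dom C y1" "y1 \<cdot> v = Id C ?R" "y2 \<cdot> v = Id C ?R"
    by (rule pullbackE[OF y, of "Id C ?R" "Id C ?R"]) (use r in auto)
  obtain s where s: "s \<in> Ar C" "Dom C s = Dom C y1" "Cod C s = Dom C p" "p \<cdot> s = Id C (Dom C y1)" "x1 \<cdot> s = y1"
    by (rule pullbackE[OF p, of "Id C (Dom C y1)" y1]) (use r yD in auto)
  obtain x w where x: "pullback C p v x w"
    by (rule finitely_complete_pullback[OF fc, of p v]) (use r pD yD v in auto)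
  note xD = pullbackD[OF x]
  \<comment> \<open>\<open>\<rho>\<close> is a candidate \<open>d\<close> with the \<open>r1\<close>
    of \<open>a\<close>. The equalizer \<open>i\<close> below adds the condition that it has the
    \<open>r2\<close> of \<open>c\<close>, which is here
    \<open>y2 \<cdot> (p \<cdot> t)\<close>.\<close>
  obtain \<rho> t where t: "pullback C r1 (r1 \<cdot> x1) \<rho> t"
    by (rule finitely_complete_pullback[OF fc, of r1 "r1 \<cdot> x1"]) (use r pD in auto)
  note tD = pullbackD[OF t]
  note Ar = r yD(1-8) pD(1-8) v(1-3) s(1-3) xD(1-8) tD(1,2,4-8)
  have parallel: "r2 \<cdot> \<rho> \<in> Ar C" "r2 \<cdot> (y2 \<cdot> (p \<cdot> t)) \<in> Ar C"
    "Dom C (r2 \<cdot> \<rho>) = Dom C (r2 \<cdot> (y2 \<cdot> (p \<cdot> t)))" "Cod C (r2 \<cdot> \<rho>) = Cod C (r2 \<cdot> (y2 \<cdot> (p \<cdot> t)))"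
    using Ar by simp_all
  obtain i where i: "mono_arr C i" "Cod C i = Dom C (r2 \<cdot> \<rho>)" "(r2 \<cdot> \<rho>) \<cdot> i = (r2 \<cdot> (y2 \<cdot> (p \<cdot> t))) \<cdot> i"
    "\<And>w. w \<in> Ar C \<Longrightarrow> Cod C w = Dom C (r2 \<cdot> \<rho>) \<Longrightarrow> (r2 \<cdot> \<rho>) \<cdot> w = (r2 \<cdot> (y2 \<cdot> (p \<cdot> t))) \<cdot> w \<Longrightarrow>
      \<exists>h. h \<in> Ar C \<and> Dom C h = Dom C w \<and> Cod C h = Dom C i \<and> i \<cdot> h = w"
    by (rule finitely_complete_equalizer[OF fc parallel]) blast
  have iAr: "i \<in> Ar C" "Cod C i = Dom C t" using mono_arr_in[OF i(1)] i(2) Ar by simp_all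
  define j where "j = t \<cdot> i"
  have jAr: "j \<in> Ar C" "Dom C j = Dom C i" "Cod C j = Dom C p" using iAr Ar by (auto simp: j_def)
  have r1i: "r1 \<cdot> (\<rho> \<cdot> (i \<cdot> g)) = r1 \<cdot> (x1 \<cdot> (j \<cdot> g))" if "g \<in> Ar C" "Cod C g = Dom C i" for g
  proof -
    have "r1 \<cdot> (\<rho> \<cdot> (i \<cdot> g)) = (r1 \<cdot> \<rho>) \<cdot> (i \<cdot> g)" using that iAr Ar by simp
    also have "\<dots> = r1 \<cdot> (x1 \<cdot> (j \<cdot> g))" unfolding tD(9) using that iAr Ar by (simp add: j_def)
    finally show ?thesis .
  qed
  have r2i: "r2 \<cdot> (\<rho> \<cdot> (i \<cdot> g)) = r2 \<cdot> (y2 \<cdot> (p \<cdot> (j \<cdot> g)))" if "g \<in> Ar C" "Cod C g = Dom C i" for g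
  proof -
    have "r2 \<cdot> (\<rho> \<cdot> (i \<cdot> g)) = ((r2 \<cdot> \<rho>) \<cdot> i) \<cdot> g" using that iAr Ar by simp
    also have "\<dots> = r2 \<cdot> (y2 \<cdot> (p \<cdot> (j \<cdot> g)))" unfolding i(3) using that iAr Ar by (simp add: j_def)
    finally show ?thesis .
  qed
  \<comment> \<open>A triple has at most one \<open>d\<close>, because \<open>r1\<close> and
    \<open>r2\<close> prescribe it: this is where joint monicity enters.\<close>
  have mono: "mono_arr C j"
    unfolding mono_arr_def
  proof (intro conjI allI ballI impI)
    fix o' g h assume g: "g \<in> Hom C o' (Dom C j)" and h: "h \<in> Hom C o' (Dom C j)" and eq: "j \<cdot> g = j \<cdot> h"
    have g': "g \<in> Ar C" "Cod C g = Dom C i" and h': "h \<in> Ar C" "Cod C h = Dom C i" "Dom C h = Dom C g"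
      using g h jAr by auto
    have "\<rho> \<cdot> (i \<cdot> g) = \<rho> \<cdot> (i \<cdot> h)"
    proof (rule jointly_monic)
      show "r1 \<cdot> (\<rho> \<cdot> (i \<cdot> g)) = r1 \<cdot> (\<rho> \<cdot> (i \<cdot> h))"
        unfolding r1i[OF g'] r1i[OF h'(1,2)] eq ..
      show "r2 \<cdot> (\<rho> \<cdot> (i \<cdot> g)) = r2 \<cdot> (\<rho> \<cdot> (i \<cdot> h))"
        unfolding r2i[OF g'] r2i[OF h'(1,2)] eq ..
    qed (use g' h' iAr Ar in auto)
    moreover have "t \<cdot> (i \<cdot> g) = t \<cdot> (i \<cdot> h)"
      using eq g' h' iAr Ar by (simp add: j_def)
    ultimately have "i \<cdot> g = i \<cdot> h"
      by (rule pullback_unique[OF t]) (use g' h' iAr Ar in auto)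
    then show "g = h" by (rule mono_arrD[OF i(1)]) (use g' h' in auto)
  qed (rule jAr)
  have lift: "\<exists>h. h \<in> Ar C \<and> Dom C h = Dom C g \<and> Cod C h = Dom C j \<and> j \<cdot> h = g"
    if g: "g \<in> Ar C" "\<sigma> \<in> Ar C" "Dom C \<sigma> = Dom C g" "Cod C g = Dom C p" "Cod C \<sigma> = ?R"
      "r1 \<cdot> \<sigma> = r1 \<cdot> (x1 \<cdot> g)" "r2 \<cdot> \<sigma> = r2 \<cdot> (y2 \<cdot> (p \<cdot> g))" for g \<sigma>
  proof -
    obtain h where h: "h \<in> Ar C" "Dom C h = Dom C g" "Cod C h = Dom C \<rho>" "\<rho> \<cdot> h = \<sigma>" "t \<cdot> h = g"
      by (rule pullbackE[OF t, of \<sigma> g]) (use g Ar in auto)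
    have "(r2 \<cdot> \<rho>) \<cdot> h = r2 \<cdot> \<sigma>"
      using h(1-4) Ar by simp
    moreover have "(r2 \<cdot> (y2 \<cdot> (p \<cdot> t))) \<cdot> h = r2 \<cdot> (y2 \<cdot> (p \<cdot> g))"
      using h(1-3,5) Ar by simp
    ultimately have "(r2 \<cdot> \<rho>) \<cdot> h = (r2 \<cdot> (y2 \<cdot> (p \<cdot> t))) \<cdot> h"
      using g(7) by simp
    moreover have "Cod C h = Dom C (r2 \<cdot> \<rho>)" using h(3) Ar by simp
    ultimately obtain k where k: "k \<in> Ar C" "Dom C k = Dom C h" "Cod C k = Dom C i" "i \<cdot> k = h"
      using i(4) h(1) by blast
    then have "j \<cdot> k = g" using h(5) iAr Ar by (simp add: j_def)
    then show ?thesis using k h(2) jAr by auto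
  qed
  obtain s' where s': "s' \<in> Ar C" "Dom C s' = Dom C s" "Cod C s' = Dom C j" "j \<cdot> s' = s"
    using lift[of s y2] s yD by auto
  have px: "y1 \<cdot> (p \<cdot> x) = w" "y2 \<cdot> (p \<cdot> x) = w"
    unfolding xD(9) using assoc[of w v y1] assoc[of w v y2] v(4,5) Ar by auto
  have "r2 \<cdot> (x1 \<cdot> x) = (r2 \<cdot> x1) \<cdot> x" using Ar by simp
  also have "\<dots> = r2 \<cdot> (y1 \<cdot> (p \<cdot> x))" unfolding pD(9)[symmetric] using Ar by simp
  finally have "r2 \<cdot> (x1 \<cdot> x) = r2 \<cdot> (y2 \<cdot> (p \<cdot> x))" unfolding px .
  then obtain x' where x': "x' \<in> Ar C" "Dom C x' = Dom C x" "Cod C x' = Dom C j" "j \<cdot> x' = x"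
    using lift[of x "x1 \<cdot> x"] Ar by auto
  have "iso_arr C j"
  proof (rule protomodular_jointly_strong_epi[OF protomodular _ x mono])
    show "point C (Dom C y1) p s" using Ar s by (simp add: point_def)
  qed (use jAr s' x' in auto)
  then obtain j' where j': "j' \<in> Ar C" "Dom C j' = Cod C j" "Cod C j' = Dom C j" "j \<cdot> j' = Id C (Cod C j)"
    by (rule iso_arrE)
  \<comment> \<open>The given \<open>b\<close>, \<open>c\<close> form a generalized element
    \<open>y\<close> of the pairs, which together with \<open>a\<close> gives an element
    \<open>g\<close> of the triples; the inverse \<open>j'\<close> then provides its
    \<open>d\<close>.\<close>
  obtain y where y': "y \<in> Ar C" "Dom C y = Dom C c" "Cod C y = Dom C y1" "y1 \<cdot> y = b" "y2 \<cdot> y = c"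
    by (rule pullbackE[OF y, of b c]) (use abc in auto)
  have "(r2 \<cdot> y1) \<cdot> y = r2 \<cdot> a" using y'(1-4) abc(9) Ar by simp
  then obtain g where g: "g \<in> Ar C" "Dom C g = Dom C c" "Cod C g = Dom C p" "p \<cdot> g = y" "x1 \<cdot> g = a"
    by (rule pullbackE[OF p]) (use abc(1-8) y'(1-3) Ar in auto)
  have jj: "j \<cdot> (j' \<cdot> g) = g" using assoc[of g j' j] j' g jAr by simp
  have jg: "j' \<cdot> g \<in> Ar C" "Cod C (j' \<cdot> g) = Dom C i" "Dom C (j' \<cdot> g) = Dom C c" using j' g jAr by auto
  show thesis
  proof (rule that[of "\<rho> \<cdot> (i \<cdot> (j' \<cdot> g))"])
    show "r1 \<cdot> (\<rho> \<cdot> (i \<cdot> (j' \<cdot> g))) = r1 \<cdot> a" unfolding r1i[OF jg(1,2)] jj g(5) ..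
    show "r2 \<cdot> (\<rho> \<cdot> (i \<cdot> (j' \<cdot> g))) = r2 \<cdot> c" unfolding r2i[OF jg(1,2)] jj g(4) y'(5) ..
  qed (use jg iAr Ar in auto)
qed

text \<open>The Mal'tsev property, argued on generalized elements: difunctionality yields symmetry
  and transitivity once the common section \<open>s\<close> supplies the diagonal pairs.\<close>

lemma reflexive_relation_equivalence:
  assumes r: "r1 \<in> Ar C" "r2 \<in> Ar C" "Dom C r2 = Dom C r1" "Cod C r1 = a" "Cod C r2 = a"
    and jointly_monic: "\<And>x y. r1 \<cdot> x = r1 \<cdot> y \<Longrightarrow> r2 \<cdot> x = r2 \<cdot> y \<Longrightarrow> x \<in> Ar C \<Longrightarrow> y \<in> Ar C \<Longrightarrow>
      Dom C x = Dom C y \<Longrightarrow> Cod C x = Dom C r1 \<Longrightarrow> Cod C y = Dom C r1 \<Longrightarrow> x = y"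
    and s: "s \<in> Ar C" "Dom C s = a" "Cod C s = Dom C r1" "r1 \<cdot> s = Id C a" "r2 \<cdot> s = Id C a"
  shows "equivalence_relation C a r1 r2"
  unfolding equivalence_relation_def
proof (intro exI[of _ "Dom C r1"] conjI allI ballI impI)
  fix z assume "z \<in> Ob C"
  let ?E = "{(r1 \<cdot> x, r2 \<cdot> x) |x. x \<in> Hom C z (Dom C r1)}"
  have diag: "r1 \<cdot> (s \<cdot> u) = u" "r2 \<cdot> (s \<cdot> u) = u" if "u \<in> Ar C" "Cod C u = a" for u
    using that assoc[of u s r1] assoc[of u s r2] r s by auto
  have elim: "\<exists>x. x \<in> Ar C \<and> Dom C x = z \<and> Cod C x = Dom C r1 \<and> u = r1 \<cdot> x \<and> v = r2 \<cdot> x"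
    if "(u, v) \<in> ?E" for u v using that by auto
  have intro: "(u, v) \<in> ?E"
    if "x \<in> Ar C" "Dom C x = z" "Cod C x = Dom C r1" "r1 \<cdot> x = u" "r2 \<cdot> x = v" for u v x
    using that by auto
  have "?E \<subseteq> Hom C z a \<times> Hom C z a" using r by auto
  moreover have "refl_on (Hom C z a) ?E"
  proof (rule refl_onI)
    fix u assume "u \<in> Hom C z a"
    then show "(u, u) \<in> ?E" using diag s by (intro intro[of "s \<cdot> u"]) auto
  qed
  moreover have "sym ?E"
  proof (rule symI)
    fix u v assume "(u, v) \<in> ?E"
    then obtain x where x: "x \<in> Ar C" "Dom C x = z" "Cod C x = Dom C r1" "u = r1 \<cdot> x" "v = r2 \<cdot> x"
      using elim by blast
    have u: "u \<in> Ar C" "Cod C u = a" "Dom C u = z" and v: "v \<in> Ar C" "Cod C v = a" "Dom C v = z"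
      using x r by auto
    \<comment> \<open>From the pairs (v, v), (u, v), (u, u) difunctionality produces (v, u).\<close>
    obtain d where "d \<in> Ar C" "Dom C d = Dom C (s \<cdot> u)" "Cod C d = Dom C r1"
      "r1 \<cdot> d = r1 \<cdot> (s \<cdot> v)" "r2 \<cdot> d = r2 \<cdot> (s \<cdot> u)"
      by (rule difunctional[OF r(1-3) jointly_monic, of "s \<cdot> v" x "s \<cdot> u"])
        (use x s u v diag in auto)
    then show "(v, u) \<in> ?E" using diag u v s by (intro intro[of d]) auto
  qed
  moreover have "trans ?E"
  proof (rule transI)
    fix u v w assume "(u, v) \<in> ?E" "(v, w) \<in> ?E"
    then obtain x y where x: "x \<in> Ar C" "Dom C x = z" "Cod C x = Dom C r1" "u = r1 \<cdot> x" "v = r2 \<cdot> x"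
      and y: "y \<in> Ar C" "Dom C y = z" "Cod C y = Dom C r1" "v = r1 \<cdot> y" "w = r2 \<cdot> y"
      using elim by meson
    have v: "v \<in> Ar C" "Cod C v = a" "Dom C v = z"
      using x r by auto
    \<comment> \<open>From the pairs (u, v), (v, v), (v, w) difunctionality produces (u, w).\<close>
    obtain d where "d \<in> Ar C" "Dom C d = Dom C y" "Cod C d = Dom C r1" "r1 \<cdot> d = r1 \<cdot> x" "r2 \<cdot> d = r2 \<cdot> y"
    proof (rule difunctional[OF r(1-3) jointly_monic, of x "s \<cdot> v" y])
      show "r2 \<cdot> x = r2 \<cdot> (s \<cdot> v)" unfolding diag[OF v(1,2)] using x(5) by simp
      show "r1 \<cdot> (s \<cdot> v) = r1 \<cdot> y" unfolding diag[OF v(1,2)] using y(4) by simp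
    qed (use x(1-3) y(1-3) s(1-3) v in auto)
    then show "(u, w) \<in> ?E" unfolding x(4) y(5) using y(2) by (intro intro[of d]) auto
  qed
  ultimately show "equiv (Hom C z a) ?E" by (auto simp: equiv_def)
next
  fix z x y assume "x \<in> Hom C z (Dom C r1)" "y \<in> Hom C z (Dom C r1)" "r1 \<cdot> x = r1 \<cdot> y \<and> r2 \<cdot> x = r2 \<cdot> y"
  then show "x = y" using jointly_monic[of x y] by simp
qed (use r in auto)

text \<open>The cokernel of \<open>f : a \<rightarrow> b\<close> is the coequalizer of \<open>[f, 1], [0, 1] : a + b \<rightarrow> b\<close>.  The image
  of this reflexive pair in \<open>b \<times> b\<close> is an equivalence relation, hence a kernel pair, and the
  coequalizer of the latter exists.\<close>

lemma cokernel_exists: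
  assumes f: "f \<in> Ar C"
  obtains q where "is_cokernel C f q"
proof -
  let ?a = "Dom C f" and ?b = "Cod C f"
  have "\<exists>c\<in>Ob C. \<exists>i \<in> Hom C ?a c. \<exists>j \<in> Hom C ?b c. \<forall>d. \<forall>f \<in> Hom C ?a d. \<forall>g \<in> Hom C ?b d.
          \<exists>!h. h \<in> Hom C c d \<and> h \<cdot> i = f \<and> h \<cdot> j = g"
    using binary_coproducts f unfolding has_binary_coproducts_def by simp
  then obtain c i j where ij: "i \<in> Hom C ?a c" "j \<in> Hom C ?b c"
    and cop: "\<And>d f g. f \<in> Hom C ?a d \<Longrightarrow> g \<in> Hom C ?b d \<Longrightarrow>
      \<exists>!h. h \<in> Hom C c d \<and> h \<cdot> i = f \<and> h \<cdot> j = g"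
    by blast
  have iAr: "i \<in> Ar C" "Dom C i = ?a" "Cod C i = c" and jAr: "j \<in> Ar C" "Dom C j = ?b" "Cod C j = c"
    using ij by auto
  obtain o' where o: "zero_arr C o'" "o' \<in> Ar C" "Dom C o' = ?a" "Cod C o' = ?b"
    using f by (rule_tac zero_arr_exists[of ?a ?b]) auto
  obtain d1 where d1: "d1 \<in> Ar C" "Dom C d1 = c" "Cod C d1 = ?b" "d1 \<cdot> i = f" "d1 \<cdot> j = Id C ?b"
    using cop[of f ?b "Id C ?b"] f by auto
  obtain d2 where d2: "d2 \<in> Ar C" "Dom C d2 = c" "Cod C d2 = ?b" "d2 \<cdot> i = o'" "d2 \<cdot> j = Id C ?b"
    using cop[of o' ?b "Id C ?b"] f o by auto
  \<comment> \<open>The product of \<open>?b\<close> with itself is formed as a pullback over a zero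
    object.\<close>
  obtain z where z: "zero_obj C z" using pointed by (auto simp: pointed_def)
  obtain tb where tb: "tb \<in> Ar C" "Dom C tb = ?b" "Cod C tb = z"
    using z f unfolding zero_obj_def by (metis Ob_Cod mem_Hom)
  obtain \<pi>1 \<pi>2 where prod: "pullback C tb tb \<pi>1 \<pi>2"
    by (rule finitely_complete_pullback[OF finitely_complete tb(1,1)]) auto
  note \<pi> = pullbackD[OF prod]
  have "tb \<cdot> d1 = tb \<cdot> d2"
    using d1 d2 tb by (intro zero_obj_terminal[OF z]) auto
  then obtain d where d: "d \<in> Ar C" "Dom C d = c" "Cod C d = Dom C \<pi>1" "\<pi>1 \<cdot> d = d1" "\<pi>2 \<cdot> d = d2"
    by (rule pullbackE[OF prod]) (use d1 d2 tb in auto)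
  obtain e m where e: "normal_epi C e" "mono_arr C m" "e \<in> Ar C" "m \<in> Ar C" "Dom C e = Dom C d"
    "Cod C m = Cod C d" "Dom C m = Cod C e" "m \<cdot> e = d"
    using d(1) by (rule normal_factorization)
  have epi: "epi_arr C e" using e(1) by (rule normal_epi_epi)
  define r1 where "r1 = \<pi>1 \<cdot> m"
  define r2 where "r2 = \<pi>2 \<cdot> m"
  have r: "r1 \<in> Ar C" "r2 \<in> Ar C" "Dom C r2 = Dom C r1" "Dom C r1 = Cod C e" "Cod C r1 = ?b" "Cod C r2 = ?b"
    using e(3-7) \<pi>(1-8) d(1-3) tb by (auto simp: r1_def r2_def)
  have re: "r1 \<cdot> e = d1" "r2 \<cdot> e = d2"
    using e(3-8) \<pi>(1-8) d tb by (auto simp: r1_def r2_def)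
  have "equivalence_relation C ?b r1 r2"
  proof (rule reflexive_relation_equivalence[OF r(1-3,5,6)])
    show "x = y" if xy: "r1 \<cdot> x = r1 \<cdot> y" "r2 \<cdot> x = r2 \<cdot> y" "x \<in> Ar C" "y \<in> Ar C"
      "Dom C x = Dom C y" "Cod C x = Dom C r1" "Cod C y = Dom C r1" for x y
    proof -
      have "m \<cdot> x = m \<cdot> y"
      proof (rule pullback_unique[OF prod])
        show "\<pi>1 \<cdot> (m \<cdot> x) = \<pi>1 \<cdot> (m \<cdot> y)" "\<pi>2 \<cdot> (m \<cdot> x) = \<pi>2 \<cdot> (m \<cdot> y)"
          using xy r(4) e(3-7) \<pi>(1-8) d(1-3) by (simp_all add: r1_def r2_def)
      qed (use xy(3-7) r(4) e(3-7) \<pi>(1-8) d(1-3) in auto)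
      then show ?thesis by (rule mono_arrD[OF e(2)]) (use xy r(4) e in auto)
    qed
    \<comment> \<open>\<open>d1\<close> and \<open>d2\<close> both restrict to the identity on the
      second summand, so \<open>e \<cdot> j\<close> is a common section.\<close>
    show "r1 \<cdot> (e \<cdot> j) = Id C ?b" "r2 \<cdot> (e \<cdot> j) = Id C ?b"
      using assoc[of j e r1] assoc[of j e r2] re d1(5) d2(5) r e(3-5) jAr d(2) by auto
  qed (use r e(3-5) jAr d(2) in auto)
  then obtain g where g: "pullback C g g r1 r2"
    using barr_exact unfolding barr_exact_def by blast
  obtain q where q: "coequalizer C r1 r2 q"
    using regular g by (rule regular_cat_coequalizer)
  note qD = coequalizerD[OF q]
  have "is_cokernel C f q"
  proof (rule is_cokernelI)
    show "epi_arr C q" using q by (rule coequalizer_epi)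
    have "q \<cdot> f = ((q \<cdot> r1) \<cdot> e) \<cdot> i"
      using qD(1-6) r re(1) e(3-5) iAr d(2) d1 by simp
    also have "\<dots> = q \<cdot> o'"
      unfolding qD(7) using qD(1-6) r re(2) e(3-5) iAr d(2) d2 by simp
    finally show "zero_arr C (q \<cdot> f)"
      using o qD(5,6) r by (metis zero_arr_comp_left)
    fix u assume u: "u \<in> Ar C" "Dom C u = ?b" "zero_arr C (u \<cdot> f)"
    have "zero_arr C (u \<cdot> o')" using o u by (intro zero_arr_comp_left) auto
    then have uo: "u \<cdot> o' = u \<cdot> f" using o u f by (intro zero_arr_unique) auto
    \<comment> \<open>\<open>u \<cdot> d1\<close> and \<open>u \<cdot> d2\<close> agree on the first
      summand because \<open>u\<close> kills \<open>f\<close>, and both are \<open>u\<close> on the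
      second. Cancelling the epimorphism \<open>e\<close> carries the equality over to
      \<open>r1\<close> and \<open>r2\<close>.\<close>
    have "\<exists>!h. h \<in> Hom C c (Cod C u) \<and> h \<cdot> i = u \<cdot> f \<and> h \<cdot> j = u"
      using u f by (intro cop) auto
    moreover have "(u \<cdot> d1) \<cdot> i = u \<cdot> f" "(u \<cdot> d1) \<cdot> j = u" "(u \<cdot> d2) \<cdot> i = u \<cdot> f" "(u \<cdot> d2) \<cdot> j = u"
      "u \<cdot> d1 \<in> Hom C c (Cod C u)" "u \<cdot> d2 \<in> Hom C c (Cod C u)"
      using d1 d2 u iAr jAr uo by simp_all
    ultimately have ud: "u \<cdot> d1 = u \<cdot> d2" by metis
    have "(u \<cdot> r1) \<cdot> e = u \<cdot> d1" "(u \<cdot> r2) \<cdot> e = u \<cdot> d2"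
      using u r re e(3-5) by simp_all
    then have "(u \<cdot> r1) \<cdot> e = (u \<cdot> r2) \<cdot> e" using ud by simp
    then have "u \<cdot> r1 = u \<cdot> r2" by (rule epi_arrD[OF epi]) (use u r in auto)
    then show "\<exists>h. h \<in> Ar C \<and> Dom C h = Cod C q \<and> Cod C h = Cod C u \<and> h \<cdot> q = u"
      by (rule coequalizerE[OF q]) (use u r in auto)
  qed (use f r qD in auto)
  then show thesis by (rule that)
qed

end

section \<open>Proper arrows\<close>

context category
begin

lemma zero_obj_iso_dom:
  assumes "zero_obj C (Cod C f)" "iso_arr C f"
  shows "zero_obj C (Dom C f)"
proof -
  obtain g where g: "f \<in> Ar C" "g \<in> Ar C" "Dom C g = Cod C f" "Cod C g = Dom C f"
    "g \<cdot> f = Id C (Dom C f)" "f \<cdot> g = Id C (Cod C f)"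
    using assms(2) by (rule iso_arrE)
  have "zero_arr C (g \<cdot> f)"
    using g assms by (intro zero_arrI) auto
  then show ?thesis using g by (intro zero_obj_if_Id_zero) auto
qed

text \<open>If \<open>e\<close> is a cokernel of \<open>g\<close>, then \<open>e'\<close> is a
  cokernel of \<open>u \<cdot> g\<close>. This is what makes \<open>EP\<close> replete.\<close>

lemma normal_epi_iso:
  assumes "normal_epi C e" "iso_arr C u" "iso_arr C v" "Dom C u = Dom C e" "Dom C v = Cod C e"
    "e' \<in> Ar C" "Dom C e' = Cod C u" "Cod C e' = Cod C v" "e' \<cdot> u = v \<cdot> e"
  shows "normal_epi C e'"
proof -
  obtain g where g: "is_cokernel C g e" using assms(1) by (auto simp: normal_epi_def)
  note gD = is_cokernelD[OF g]
  have u: "u \<in> Ar C" using assms(2) by (simp add: iso_arr_def)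
  obtain v' where v: "v \<in> Ar C" "v' \<in> Ar C" "Dom C v' = Cod C v" "Cod C v' = Dom C v"
    "v' \<cdot> v = Id C (Dom C v)" "v \<cdot> v' = Id C (Cod C v)"
    using assms(3) by (rule iso_arrE)
  have "is_cokernel C (u \<cdot> g) e'"
  proof (rule is_cokernelI)
    show "epi_arr C e'"
      unfolding epi_arr_def
    proof (intro conjI allI ballI impI)
      fix b x y assume "x \<in> Hom C (Cod C e') b" "y \<in> Hom C (Cod C e') b" and eq: "x \<cdot> e' = y \<cdot> e'"
      then have xy: "x \<in> Ar C" "y \<in> Ar C" "Dom C x = Cod C v" "Dom C y = Cod C v" "Cod C x = Cod C y"
        using assms(8) by auto
      have "(x \<cdot> v) \<cdot> e = x \<cdot> (e' \<cdot> u)"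
        unfolding assms(9) using xy v(1) gD(2) assms(5) by simp
      also have "\<dots> = (x \<cdot> e') \<cdot> u" using xy u assms(6-8) by simp
      also have "\<dots> = y \<cdot> (e' \<cdot> u)" unfolding eq using xy u assms(6-8) by simp
      also have "\<dots> = (y \<cdot> v) \<cdot> e"
        unfolding assms(9) using xy v(1) gD(2) assms(5) by simp
      finally have "x \<cdot> v = y \<cdot> v"
        by (rule epi_arrD[OF is_cokernel_epi[OF g]]) (use xy v assms(5) in auto)
      then show "x = y" by (rule iso_arr_cancel[OF assms(3)]) (use xy in auto)
    qed (rule assms(6))
    have "e' \<cdot> (u \<cdot> g) = (e' \<cdot> u) \<cdot> g" using u gD(1-3) assms(4,6,7) by simp
    also have "\<dots> = v \<cdot> (e \<cdot> g)" unfolding assms(9) using v(1) gD(1-3) assms(5) by simp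
    also have "zero_arr C \<dots>" using v(1) gD(1-3) assms(5) by (intro zero_arr_comp_left[OF gD(4)]) auto
    finally show "zero_arr C (e' \<cdot> (u \<cdot> g))" .
    fix w assume w: "w \<in> Ar C" "Dom C w = Cod C (u \<cdot> g)" "zero_arr C (w \<cdot> (u \<cdot> g))"
    have w': "Dom C w = Cod C u" using w(2) u gD(1-3) assms(4) by simp
    have "zero_arr C ((w \<cdot> u) \<cdot> g)" using w(1,3) w' u gD(1-3) assms(4) by simp
    then obtain h where h: "h \<in> Ar C" "Dom C h = Cod C e" "Cod C h = Cod C w" "h \<cdot> e = w \<cdot> u"
      by (rule is_cokernelE[OF g]) (use w(1) w' u gD(1-3) assms(4) in auto)
    have "((h \<cdot> v') \<cdot> e') \<cdot> u = (h \<cdot> v') \<cdot> (v \<cdot> e)"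
      unfolding assms(9)[symmetric] using h(1,2) v(1-4) u assms(5-8) by simp
    also have "\<dots> = h \<cdot> ((v' \<cdot> v) \<cdot> e)" using h(1,2) v(1-4) gD(2) assms(5) by simp
    also have "\<dots> = w \<cdot> u" using h(1,2,4) v(5) gD(2) assms(5) by simp
    finally have "(h \<cdot> v') \<cdot> e' = w"
      by (rule iso_arr_cancel[OF assms(2)]) (use h(1,2) v(1-4) w(1) w' assms(5-8) in auto)
    then show "\<exists>h. h \<in> Ar C \<and> Dom C h = Cod C e' \<and> Cod C h = Cod C w \<and> h \<cdot> e' = w"
      using h(1-3) v(1-4) assms(5,8) by (intro exI[of _ "h \<cdot> v'"]) auto
  qed (use u gD assms in auto)
  then show ?thesis by (auto simp: normal_epi_def)
qed

text \<open>Whatever arrow has \<open>n\<close> as kernel also has \<open>m\<close> as kernel. This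
  transports normality between the images in different factorizations of one arrow.\<close>

lemma normal_mono_if_same_subobject:
  assumes "normal_mono C n" "mono_arr C m" "s \<in> Ar C" "Dom C s = Dom C n" "Cod C s = Dom C m" "m \<cdot> s = n"
    "t \<in> Ar C" "Dom C t = Dom C m" "Cod C t = Dom C n" "n \<cdot> t = m"
  shows "normal_mono C m"
proof -
  obtain f where f: "is_kernel C f n" using assms(1) by (auto simp: normal_mono_def)
  note fD = is_kernelD[OF f]
  have m: "m \<in> Ar C" using assms(2) by (rule mono_arr_in)
  have "Cod C (m \<cdot> s) = Cod C m" using m assms(3,5) by simp
  then have cod: "Cod C m = Dom C f" using assms(6) fD(3) by simp
  have "is_kernel C f m"
  proof (rule is_kernelI)
    have "zero_arr C ((f \<cdot> n) \<cdot> t)"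
      using fD(1-3) assms(7-9) by (intro zero_arr_comp_right[OF fD(4)]) auto
    then show "zero_arr C (f \<cdot> m)"
      using fD(1-3) assms(7-9) unfolding assms(10)[symmetric] by simp
    fix u assume u: "u \<in> Ar C" "Cod C u = Dom C f" "zero_arr C (f \<cdot> u)"
    obtain h where h: "h \<in> Ar C" "Dom C h = Dom C u" "Cod C h = Dom C n" "n \<cdot> h = u"
      by (rule is_kernelE[OF f u(3,1,2)])
    have "m \<cdot> (s \<cdot> h) = (m \<cdot> s) \<cdot> h" using h(1-3) m assms(3-5) by simp
    also have "\<dots> = u" unfolding assms(6) by (rule h(4))
    finally have "m \<cdot> (s \<cdot> h) = u" .
    then show "\<exists>h. h \<in> Ar C \<and> Dom C h = Dom C u \<and> Cod C h = Dom C m \<and> m \<cdot> h = u"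
      using h(1-3) assms(3-5) by (intro exI[of _ "s \<cdot> h"]) auto
  qed (use fD(1) assms(2) cod in auto)
  then show ?thesis by (auto simp: normal_mono_def)
qed

end

context semi_abelian
begin

lemma the_zero: "zero_obj C (the_zero C)"
  using pointed unfolding pointed_def the_zero_def by (rule someI_ex)

lemma the_zero_arr:
  assumes "a \<in> Ob C" "b \<in> Ob C"
  shows "the_zero_arr C a b \<in> Ar C" "Dom C (the_zero_arr C a b) = a" "Cod C (the_zero_arr C a b) = b"
    "zero_arr C (the_zero_arr C a b)"
proof -
  obtain f where f: "zero_arr C f" "f \<in> Ar C" "Dom C f = a" "Cod C f = b"
    using assms by (rule zero_arr_exists)
  have "the_zero_arr C a b \<in> Hom C a b \<and> zero_arr C (the_zero_arr C a b)"
    unfolding the_zero_arr_def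
  proof (rule theI[of _ f])
    fix g assume "g \<in> Hom C a b \<and> zero_arr C g"
    then show "g = f" using f by (intro zero_arr_unique) auto
  qed (use f in auto)
  then show "the_zero_arr C a b \<in> Ar C" "Dom C (the_zero_arr C a b) = a"
    "Cod C (the_zero_arr C a b) = b" "zero_arr C (the_zero_arr C a b)" by auto
qed

text \<open>If \<open>e\<close> is a cokernel of \<open>g\<close>, then
  \<open>m \<cdot> (w \<cdot> g)\<close> is zero; cancelling \<open>m\<close> shows that
  \<open>w\<close> kills \<open>g\<close> and hence factors through \<open>e\<close>.\<close>

lemma normal_epi_mono_diagonal:
  assumes "normal_epi C e" "mono_arr C m" "m \<cdot> w = v \<cdot> e" "w \<in> Ar C" "v \<in> Ar C" "Dom C w = Dom C e"
    "Cod C w = Dom C m" "Dom C v = Cod C e" "Cod C v = Cod C m"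
  obtains d where "d \<in> Ar C" "Dom C d = Cod C e" "Cod C d = Dom C m" "d \<cdot> e = w" "m \<cdot> d = v"
proof -
  obtain g where g: "is_cokernel C g e" using assms(1) by (auto simp: normal_epi_def)
  note gD = is_cokernelD[OF g]
  have m: "m \<in> Ar C" using assms(2) by (rule mono_arr_in)
  have "m \<cdot> (w \<cdot> g) = (m \<cdot> w) \<cdot> g" using m gD(1-3) assms(4-8) by simp
  also have "\<dots> = v \<cdot> (e \<cdot> g)" unfolding assms(3) using gD(1-3) assms(4-8) by simp
  also have "zero_arr C \<dots>" using gD(1-3) assms(4-8) by (intro zero_arr_comp_left[OF gD(4)]) auto
  finally have "zero_arr C (w \<cdot> g)"
    by (rule mono_zero_cancel[OF assms(2)]) (use gD(1-3) assms(4-8) in auto)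
  then obtain d where d: "d \<in> Ar C" "Dom C d = Cod C e" "Cod C d = Cod C w" "d \<cdot> e = w"
    by (rule is_cokernelE[OF g]) (use gD(1-3) assms(4-8) in auto)
  have "(m \<cdot> d) \<cdot> e = v \<cdot> e" using d m gD(2) assms(3,7) by simp
  then have "m \<cdot> d = v"
    by (rule epi_arrD[OF normal_epi_epi[OF assms(1)]]) (use d m assms in auto)
  then show thesis using that d assms(7) by simp
qed

text \<open>Such an \<open>m\<close> is a kernel of the identity: an arrow killed by the identity is
  zero and so factors through \<open>m\<close> by a zero arrow.\<close>

lemma zero_mono_normal:
  assumes "mono_arr C m" "zero_arr C m"
  shows "normal_mono C m"
proof -
  have m: "m \<in> Ar C" using assms(1) by (rule mono_arr_in)
  have "is_kernel C (Id C (Cod C m)) m"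
  proof (rule is_kernelI)
    fix u assume u: "u \<in> Ar C" "Cod C u = Dom C (Id C (Cod C m))" "zero_arr C (Id C (Cod C m) \<cdot> u)"
    obtain h where h: "zero_arr C h" "h \<in> Ar C" "Dom C h = Dom C u" "Cod C h = Dom C m"
      using u(1) m by (rule_tac zero_arr_exists[of "Dom C u" "Dom C m"]) auto
    have "zero_arr C (m \<cdot> h)" using h m by (intro zero_arr_comp_left) auto
    then have "m \<cdot> h = u" using u h m by (intro zero_arr_unique) auto
    then show "\<exists>h. h \<in> Ar C \<and> Dom C h = Dom C u \<and> Cod C h = Dom C m \<and> m \<cdot> h = u"
      using h by auto
  qed (use assms m in auto)
  then show ?thesis by (auto simp: normal_mono_def)
qed

lemma proper_arr_zero:
  assumes "zero_arr C f"
  shows "proper_arr C f"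
  unfolding proper_arr_def
proof (intro allI impI, elim conjE)
  fix e m assume em: "normal_epi C e" "mono_arr C m" "Cod C e = Dom C m" "f = m \<cdot> e"
  have "zero_arr C (m \<cdot> e)" using assms em(4) by simp
  then have "zero_arr C m"
    by (rule epi_zero_cancel[OF normal_epi_epi[OF em(1)]]) (use em mono_arr_in in auto)
  then show "normal_mono C m" by (rule zero_mono_normal[OF em(2)])
qed

text \<open>Lifting \<open>f\<close> against \<open>m\<close> splits the monomorphism
  \<open>m\<close>, so \<open>m\<close> is the whole subobject, and the identity is normal as kernel
  of an arrow to a zero object.\<close>

lemma proper_arr_normal_epi:
  assumes "normal_epi C f"
  shows "proper_arr C f"
  unfolding proper_arr_def
proof (intro allI impI, elim conjE)
  fix e m assume em: "normal_epi C e" "mono_arr C m" "Cod C e = Dom C m" "f = m \<cdot> e"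
  have e: "e \<in> Ar C" and m: "m \<in> Ar C"
    using em(1,2) normal_epi_epi epi_arr_in mono_arr_in by auto
  have f: "f \<in> Ar C" "Dom C f = Dom C e" "Cod C f = Cod C m"
    using em(3,4) e m by auto
  have "m \<cdot> e = Id C (Cod C m) \<cdot> f" using em(4) f by simp
  then obtain d where d: "d \<in> Ar C" "Dom C d = Cod C f" "Cod C d = Dom C m" "m \<cdot> d = Id C (Cod C m)"
    by (rule normal_epi_mono_diagonal[OF assms em(2)]) (use e m f em(3) in auto)
  obtain o' where o: "zero_obj C (the_zero C)" "o' \<in> Ar C" "Dom C o' = Cod C m" "Cod C o' = the_zero C"
    using the_zero m unfolding zero_obj_def by (metis Ob_Cod mem_Hom)
  have "is_kernel C o' (Id C (Dom C o'))" using o by (intro is_kernel_Id) auto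
  then have "normal_mono C (Id C (Cod C m))" using o by (auto simp: normal_mono_def)
  then show "normal_mono C m"
    by (rule normal_mono_if_same_subobject[OF _ em(2), of _ d m]) (use d m f in auto)
qed

text \<open>Precomposition with a normal epimorphism leaves the image unchanged. The comparison
  arrows come from lifting \<open>e0\<close>, \<open>c\<close> and \<open>e\<close> in turn, which
  avoids proving that \<open>e \<cdot> c\<close> is a normal epimorphism.\<close>

lemma proper_arr_descend:
  assumes "proper_arr C f" "f \<in> Ar C" "normal_epi C c" "d \<in> Ar C" "Dom C d = Cod C c" "d \<cdot> c = f"
  shows "proper_arr C d"
  unfolding proper_arr_def
proof (intro allI impI, elim conjE)
  fix e m assume em: "normal_epi C e" "mono_arr C m" "Cod C e = Dom C m" "d = m \<cdot> e"
  have e: "e \<in> Ar C" and m: "m \<in> Ar C" and c: "c \<in> Ar C"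
    using em(1,2) assms(3) normal_epi_epi epi_arr_in mono_arr_in by auto
  have e_dom: "Dom C e = Cod C c" using em(3,4) e m assms(5) by simp
  have f: "Dom C f = Dom C c" "Cod C f = Cod C m" "m \<cdot> (e \<cdot> c) = f"
    using assms(4-6) em(3,4) e m c e_dom by auto
  obtain e0 m0 where f0: "normal_epi C e0" "mono_arr C m0" "e0 \<in> Ar C" "m0 \<in> Ar C" "Dom C e0 = Dom C f"
    "Cod C m0 = Cod C f" "Dom C m0 = Cod C e0" "m0 \<cdot> e0 = f"
    using assms(2) by (rule normal_factorization)
  have m0: "normal_mono C m0" using assms(1) f0 by (auto simp: proper_arr_def)
  have "m \<cdot> (e \<cdot> c) = m0 \<cdot> e0" using f(3) f0(8) by simp
  then obtain s where s: "s \<in> Ar C" "Dom C s = Cod C e0" "Cod C s = Dom C m" "m \<cdot> s = m0"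
    by (rule normal_epi_mono_diagonal[OF f0(1) em(2)]) (use f f0(3-7) e m c e_dom em(3) in auto)
  have "m0 \<cdot> e0 = (m \<cdot> e) \<cdot> c" using f(3) f0(8) e m c e_dom em(3) by simp
  then obtain r where r: "r \<in> Ar C" "Dom C r = Cod C c" "Cod C r = Dom C m0" "m0 \<cdot> r = m \<cdot> e"
    by (rule normal_epi_mono_diagonal[OF assms(3) f0(2)]) (use f f0(3-7) e m c e_dom em(3) in auto)
  obtain t where t: "t \<in> Ar C" "Dom C t = Cod C e" "Cod C t = Dom C m0" "m0 \<cdot> t = m"
    by (rule normal_epi_mono_diagonal[OF em(1) f0(2) r(4)]) (use r f f0(3-7) e m c e_dom em(3) in auto)
  show "normal_mono C m"
    by (rule normal_mono_if_same_subobject[OF m0 em(2), of s t]) (use s t f0(7) em(3) in auto)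
qed

end

section \<open>Categories of chain complexes\<close>

lemma ch_simps [simp]:
  "Ob (ch C) = {M. chain_complex C M}" "Dom (ch C) = src" "Cod (ch C) = tgt"
  "Id (ch C) M = \<lparr>src = M, tgt = M, cmpt = (\<lambda>i. Id C (deg M i))\<rparr>"
  "g \<cdot>\<^bsub>ch C\<^esub> f = \<lparr>src = src f, tgt = tgt g, cmpt = (\<lambda>i. cmpt g i \<cdot>\<^bsub>C\<^esub> cmpt f i)\<rparr>"
  by (simp_all add: ch_def)

lemma ch_ArI:
  assumes "chain_complex C (src f)" "chain_complex C (tgt f)"
    "\<And>i. cmpt f i \<in> Ar C" "\<And>i. Dom C (cmpt f i) = deg (src f) i" "\<And>i. Cod C (cmpt f i) = deg (tgt f) i"
    "\<And>i. bd (tgt f) i \<cdot>\<^bsub>C\<^esub> cmpt f i = cmpt f (i - 1) \<cdot>\<^bsub>C\<^esub> bd (src f) i"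
  shows "f \<in> Ar (ch C)"
  using assms by (simp add: ch_def)

lemma ch_ArD:
  assumes "f \<in> Ar (ch C)"
  shows "chain_complex C (src f)" "chain_complex C (tgt f)"
    "cmpt f i \<in> Ar C" "Dom C (cmpt f i) = deg (src f) i" "Cod C (cmpt f i) = deg (tgt f) i"
    "bd (tgt f) i \<cdot>\<^bsub>C\<^esub> cmpt f i = cmpt f (i - 1) \<cdot>\<^bsub>C\<^esub> bd (src f) i"
  using assms by (simp_all add: ch_def)

lemma chain_map_eqI:
  fixes f g :: "('o, 'm) chain_map"
  assumes "src f = src g" "tgt f = tgt g" "\<And>i. cmpt f i = cmpt g i"
  shows "f = g"
  using assms by (cases f, cases g) auto

lemma chain_complexD:
  assumes "chain_complex C M"
  shows "deg M i \<in> Ob C" "bd M i \<in> Ar C" "Dom C (bd M i) = deg M i" "Cod C (bd M i) = deg M (i - 1)"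
    "zero_arr C (bd M i \<cdot>\<^bsub>C\<^esub> bd M (i + 1))"
  using assms by (simp_all add: chain_complex_def)

text \<open>Meant for a zero object \<open>z\<close>, whose identity is a zero arrow and can
  therefore serve as boundary.\<close>

definition const_chain :: "('o, 'm) cat \<Rightarrow> 'o \<Rightarrow> ('o, 'm) chain" where
  "const_chain C z = \<lparr>deg = (\<lambda>_. z), bd = (\<lambda>_. Id C z)\<rparr>"

context category
begin

lemma full_subcat_iso_arr:
  assumes "iso_arr (full_subcat C S) f"
  shows "iso_arr C f"
  using assms unfolding iso_arr_def full_subcat_def by auto

text \<open>Being zero in the subcategory requires a factorization through an object of
  \<open>S\<close>; by uniqueness of zero arrows, \<open>f\<close> can be rerouted through
  \<open>z\<close>.\<close>

lemma full_subcat_zero_arr: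
  assumes "zero_obj C z" "z \<in> S" "zero_arr C f" "Dom C f \<in> S" "Cod C f \<in> S"
  shows "zero_arr (full_subcat C S) f"
proof -
  have f: "f \<in> Ar C" using assms(3) by (rule zero_arr_in)
  obtain g where g: "g \<in> Ar C" "Dom C g = Dom C f" "Cod C g = z"
    using assms(1) f unfolding zero_obj_def by (metis Ob_Dom mem_Hom)
  obtain h where h: "h \<in> Ar C" "Dom C h = z" "Cod C h = Cod C f"
    using assms(1) f unfolding zero_obj_def by (metis Ob_Cod mem_Hom)
  have "zero_arr C (h \<cdot> g)" using g h assms(1) by (intro zero_arrI) auto
  then have "f = h \<cdot> g" using g h assms(3) by (intro zero_arr_unique) auto
  moreover have "zero_obj (full_subcat C S) z"
  proof -
    have "Hom (full_subcat C S) a b = Hom C a b" if "a \<in> S" "b \<in> S" for a b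
      using that by (auto simp: full_subcat_def)
    moreover have "Ob (full_subcat C S) = Ob C \<inter> S" by (simp add: full_subcat_def)
    ultimately show ?thesis using assms(1,2) by (auto simp: zero_obj_def simp del: mem_Hom)
  qed
  ultimately show ?thesis
    using f g h assms(2,4,5) unfolding zero_arr_def full_subcat_def by fastforce
qed

lemma category_ch: "category (ch C)"
proof
  fix M assume "M \<in> Ob (ch C)"
  then have M: "chain_complex C M" by simp
  then show "Id (ch C) M \<in> Hom (ch C) M M"
    by (auto intro!: ch_ArI simp: chain_complexD)
next
  fix f g L M N
  assume "f \<in> Hom (ch C) L M" "g \<in> Hom (ch C) M N"
  then have f: "f \<in> Ar (ch C)" "src f = L" "tgt f = M" and g: "g \<in> Ar (ch C)" "src g = M" "tgt g = N"
    by auto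
  note fD = ch_ArD[OF f(1), unfolded f(2,3)] and gD = ch_ArD[OF g(1), unfolded g(2,3)]
  have "bd N i \<cdot> (cmpt g i \<cdot> cmpt f i) = (cmpt g (i - 1) \<cdot> cmpt f (i - 1)) \<cdot> bd L i" for i
  proof -
    note L = chain_complexD[OF fD(1)] and M = chain_complexD[OF fD(2)] and N = chain_complexD[OF gD(2)]
    have "bd N i \<cdot> (cmpt g i \<cdot> cmpt f i) = (bd N i \<cdot> cmpt g i) \<cdot> cmpt f i"
      using fD(3-5) gD(3-5) N by simp
    also have "\<dots> = cmpt g (i - 1) \<cdot> (bd M i \<cdot> cmpt f i)"
      unfolding gD(6) using fD(3-5) gD(3-5) M by simp
    also have "\<dots> = (cmpt g (i - 1) \<cdot> cmpt f (i - 1)) \<cdot> bd L i"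
      unfolding fD(6) using fD(3-5) gD(3-5) L by simp
    finally show ?thesis .
  qed
  then show "g \<cdot>\<^bsub>ch C\<^esub> f \<in> Hom (ch C) L N"
    using f(2) g(3) fD(1-5) gD(1-5) by (auto intro!: ch_ArI)
qed (auto simp: ch_ArD intro!: chain_map_eqI)

lemma iso_arr_ch:
  assumes "iso_arr (ch C) f"
  shows "iso_arr C (cmpt f i)"
proof -
  obtain g where g: "f \<in> Ar (ch C)" "g \<in> Ar (ch C)" "src g = tgt f" "tgt g = src f"
    "g \<cdot>\<^bsub>ch C\<^esub> f = Id (ch C) (src f)" "f \<cdot>\<^bsub>ch C\<^esub> g = Id (ch C) (tgt f)"
    using assms unfolding iso_arr_def by auto
  have "cmpt g i \<cdot> cmpt f i = Id C (deg (src f) i)" "cmpt f i \<cdot> cmpt g i = Id C (deg (tgt f) i)"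
    using g(5,6) by (auto dest: fun_cong)
  then show ?thesis
    using ch_ArD[OF g(1)] ch_ArD[OF g(2)] g(3,4)
    unfolding iso_arr_def by (auto intro!: bexI[of _ "cmpt g i"])
qed

lemma zero_chain_complex:
  assumes "zero_obj C z"
  shows "chain_complex C (const_chain C z)"
  using assms zero_obj_in[OF assms] zero_arr_to_zero[of "Id C z"]
  by (simp add: chain_complex_def const_chain_def)

lemma zero_obj_ch:
  assumes z: "zero_obj C z"
  shows "zero_obj (ch C) (const_chain C z)"
  unfolding zero_obj_def
proof (intro conjI ballI)
  let ?O = "const_chain C z"
  have zOb: "z \<in> Ob C" using z by (rule zero_obj_in)
  have O: "chain_complex C ?O" using z by (rule zero_chain_complex)
  then show "?O \<in> Ob (ch C)" by simp
  fix M assume "M \<in> Ob (ch C)"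
  then have M: "chain_complex C M" by simp
  note MD = chain_complexD[OF M]
  have "\<exists>h. h \<in> Ar C \<and> Dom C h = z \<and> Cod C h = deg M i" for i
    using z MD(1)[of i] unfolding zero_obj_def by (metis mem_Hom)
  then obtain h where h: "\<And>i. h i \<in> Ar C" "\<And>i. Dom C (h i) = z" "\<And>i. Cod C (h i) = deg M i"
    by metis
  have "\<exists>h. h \<in> Ar C \<and> Dom C h = deg M i \<and> Cod C h = z" for i
    using z MD(1)[of i] unfolding zero_obj_def by (metis mem_Hom)
  then obtain g where g: "\<And>i. g i \<in> Ar C" "\<And>i. Dom C (g i) = deg M i" "\<And>i. Cod C (g i) = z"
    by metis
  show "\<exists>!f. f \<in> Hom (ch C) ?O M"
  proof (rule ex1I[of _ "\<lparr>src = ?O, tgt = M, cmpt = h\<rparr>"])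
    have "bd M i \<cdot> h i = h (i - 1) \<cdot> Id C z" for i
      using h MD zOb by (intro zero_obj_initial[OF z]) auto
    then show "\<lparr>src = ?O, tgt = M, cmpt = h\<rparr> \<in> Hom (ch C) ?O M"
      using h O M by (auto intro!: ch_ArI simp: const_chain_def)
    fix f assume "f \<in> Hom (ch C) ?O M"
    then have f: "f \<in> Ar (ch C)" "src f = ?O" "tgt f = M" by auto
    have "cmpt f i = h i" for i
      using ch_ArD(3-5)[OF f(1)] f(2,3) h by (intro zero_obj_initial[OF z]) (auto simp: const_chain_def)
    then show "f = \<lparr>src = ?O, tgt = M, cmpt = h\<rparr>" using f by (intro chain_map_eqI) auto
  qed
  show "\<exists>!f. f \<in> Hom (ch C) M ?O"
  proof (rule ex1I[of _ "\<lparr>src = M, tgt = ?O, cmpt = g\<rparr>"])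
    show "\<lparr>src = M, tgt = ?O, cmpt = g\<rparr> \<in> Hom (ch C) M ?O"
      using g O M MD by (auto intro!: ch_ArI zero_obj_terminal[OF z] simp: const_chain_def)
    fix f assume "f \<in> Hom (ch C) M ?O"
    then have f: "f \<in> Ar (ch C)" "src f = M" "tgt f = ?O" by auto
    have "cmpt f i = g i" for i
      using ch_ArD(3-5)[OF f(1)] f(2,3) g by (intro zero_obj_terminal[OF z]) (auto simp: const_chain_def)
    then show "f = \<lparr>src = M, tgt = ?O, cmpt = g\<rparr>" using f by (intro chain_map_eqI) auto
  qed
qed

end

section \<open>Zero maps, kernels and cokernels of complexes, degree by degree\<close>

context semi_abelian
begin

interpretation ch: category "ch C"
  by (rule category_ch)

text \<open>Both implications compare \<open>f\<close> with a composite through the constant zero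
  complex, using uniqueness of zero arrows in \<open>ch C\<close> for one and in each degree for the
  other.\<close>

lemma zero_arr_ch_iff:
  assumes f: "f \<in> Ar (ch C)"
  shows "zero_arr (ch C) f \<longleftrightarrow> (\<forall>i. zero_arr C (cmpt f i))"
proof -
  obtain z where z: "zero_obj C z" using pointed by (auto simp: pointed_def)
  let ?O = "const_chain C z"
  have O: "zero_obj (ch C) ?O" using z by (rule zero_obj_ch)
  note fD = ch_ArD[OF f]
  obtain g where g: "g \<in> Ar (ch C)" "src g = src f" "tgt g = ?O"
    using O fD(1) unfolding zero_obj_def by auto
  obtain h where h: "h \<in> Ar (ch C)" "src h = ?O" "tgt h = tgt f"
    using O fD(2) unfolding zero_obj_def by auto
  let ?f = "h \<cdot>\<^bsub>ch C\<^esub> g"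
  have "\<forall>i. zero_arr C (cmpt ?f i)"
    using ch_ArD(3-5)[OF g(1)] ch_ArD(3-5)[OF h(1)] g(2,3) h(2,3) z by (auto intro!: zero_arrI simp: const_chain_def)
  moreover have "zero_arr (ch C) ?f"
    using O g h by (intro ch.zero_arrI) auto
  moreover have "f = ?f" if "zero_arr (ch C) f"
    using that \<open>zero_arr (ch C) ?f\<close> g h by (intro ch.zero_arr_unique) auto
  moreover have "f = ?f" if zero: "\<forall>i. zero_arr C (cmpt f i)"
  proof (rule chain_map_eqI)
    fix i
    have "?f \<in> Ar (ch C)" using g h by (intro ch.comp_simps) auto
    note f'D = ch_ArD(4,5)[OF this, of i]
    show "cmpt f i = cmpt ?f i"
      using zero \<open>\<forall>i. zero_arr C (cmpt ?f i)\<close> fD(4,5) f'D g(2) h(3) by (intro zero_arr_unique) auto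
  qed (use g h in auto)
  ultimately show ?thesis by metis
qed

text \<open>The identity of \<open>Z\<close> is a zero arrow, hence so is each of its
  components.\<close>

lemma zero_obj_ch_deg:
  assumes "zero_obj (ch C) Z"
  shows "zero_obj C (deg Z i)"
proof -
  have Z: "chain_complex C Z" using assms by (simp add: zero_obj_def)
  have "zero_arr (ch C) (Id (ch C) Z)"
    using assms Z ch.Id_simps[of Z] by (intro ch.zero_arr_to_zero) auto
  then have "zero_arr C (Id C (deg Z i))"
    using zero_arr_ch_iff[of "Id (ch C) Z"] ch.Id_simps(1)[of Z] Z by auto
  then show ?thesis using chain_complexD(1)[OF Z] by (intro zero_obj_if_Id_zero)
qed

text \<open>The lifts chosen in each degree form a chain map because they commute with the
  boundaries after composition with the monomorphism \<open>cmpt k (i - 1)\<close>.\<close>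

lemma is_kernel_ch:
  assumes k: "k \<in> Ar (ch C)" and q: "q \<in> Ar (ch C)" and kq: "tgt k = src q"
    and ker: "\<And>i. is_kernel C (cmpt q i) (cmpt k i)"
  shows "is_kernel (ch C) q k"
proof (rule ch.is_kernelI)
  note kD = ch_ArD[OF k] and qD = ch_ArD[OF q]
  note K = chain_complexD[OF kD(1)] and M = chain_complexD[OF kD(2)]
  have mono: "mono_arr C (cmpt k i)" for i using ker by (rule is_kernel_mono)
  show "mono_arr (ch C) k"
    unfolding mono_arr_def
  proof (intro conjI allI ballI impI)
    fix L u v assume "u \<in> Hom (ch C) L (Dom (ch C) k)" "v \<in> Hom (ch C) L (Dom (ch C) k)"
      and eq: "k \<cdot>\<^bsub>ch C\<^esub> u = k \<cdot>\<^bsub>ch C\<^esub> v"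
    then have u: "u \<in> Ar (ch C)" "src u = L" "tgt u = src k" and v: "v \<in> Ar (ch C)" "src v = L" "tgt v = src k"
      by auto
    show "u = v"
    proof (rule chain_map_eqI)
      fix i
      have "cmpt k i \<cdot> cmpt u i = cmpt k i \<cdot> cmpt v i" using eq by (auto dest: fun_cong)
      then show "cmpt u i = cmpt v i"
        by (rule mono_arrD[OF mono]) (use ch_ArD[OF u(1)] ch_ArD[OF v(1)] u v kD in auto)
    qed (use u v in auto)
  qed (rule k)
  have "q \<cdot>\<^bsub>ch C\<^esub> k \<in> Ar (ch C)" using k q kq by (intro ch.comp_simps) auto
  from zero_arr_ch_iff[OF this] show "zero_arr (ch C) (q \<cdot>\<^bsub>ch C\<^esub> k)"
    using is_kernelD(4)[OF ker] by simp
  fix u assume u: "u \<in> Ar (ch C)" "Cod (ch C) u = Dom (ch C) q" "zero_arr (ch C) (q \<cdot>\<^bsub>ch C\<^esub> u)"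
  note uD = ch_ArD[OF u(1)]
  have tu: "tgt u = tgt k" using u(2) kq by simp
  have "q \<cdot>\<^bsub>ch C\<^esub> u \<in> Ar (ch C)" using u q by (intro ch.comp_simps) auto
  from zero_arr_ch_iff[OF this] have "zero_arr C (cmpt q i \<cdot> cmpt u i)" for i
    using u(3) by simp
  then have "\<exists>h. h \<in> Ar C \<and> Dom C h = deg (src u) i \<and> Cod C h = deg (src k) i \<and> cmpt k i \<cdot> h = cmpt u i" for i
    by (rule is_kernelE[OF ker]) (use uD kD qD tu kq in auto)
  then obtain h where h: "\<And>i. h i \<in> Ar C" "\<And>i. Dom C (h i) = deg (src u) i"
    "\<And>i. Cod C (h i) = deg (src k) i" "\<And>i. cmpt k i \<cdot> h i = cmpt u i"
    by metis
  note U = chain_complexD[OF uD(1)]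
  have "bd (src k) i \<cdot> h i = h (i - 1) \<cdot> bd (src u) i" for i
  proof -
    have "cmpt k (i - 1) \<cdot> (bd (src k) i \<cdot> h i) = (cmpt k (i - 1) \<cdot> bd (src k) i) \<cdot> h i"
      using h(1-3) kD(3-5) K by simp
    also have "\<dots> = bd (tgt k) i \<cdot> (cmpt k i \<cdot> h i)"
      unfolding kD(6)[symmetric] using h(1-3) kD(3-5) M by simp
    also have "\<dots> = (cmpt k (i - 1) \<cdot> h (i - 1)) \<cdot> bd (src u) i"
      unfolding h(4) tu[symmetric] by (rule uD(6))
    also have "\<dots> = cmpt k (i - 1) \<cdot> (h (i - 1) \<cdot> bd (src u) i)"
      using h(1-3) kD(3-5) U by simp
    finally show ?thesis
      by (rule mono_arrD[OF mono]) (use h(1-3) kD(3-5) U K in auto)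
  qed
  then have "\<lparr>src = src u, tgt = src k, cmpt = h\<rparr> \<in> Ar (ch C)"
    using h kD uD by (auto intro!: ch_ArI)
  moreover have "k \<cdot>\<^bsub>ch C\<^esub> \<lparr>src = src u, tgt = src k, cmpt = h\<rparr> = u"
    using h(4) tu by (intro chain_map_eqI) auto
  ultimately show "\<exists>h. h \<in> Ar (ch C) \<and> Dom (ch C) h = Dom (ch C) u \<and> Cod (ch C) h = Dom (ch C) k \<and>
      k \<cdot>\<^bsub>ch C\<^esub> h = u"
    by (intro exI[of _ "\<lparr>src = src u, tgt = src k, cmpt = h\<rparr>"]) simp
qed (use assms in auto)

text \<open>Dual to the kernel case; here the epimorphism \<open>cmpt q i\<close> is
  cancelled.\<close>

lemma is_cokernel_ch:
  assumes k: "k \<in> Ar (ch C)" and q: "q \<in> Ar (ch C)" and kq: "tgt k = src q"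
    and coker: "\<And>i. is_cokernel C (cmpt k i) (cmpt q i)"
  shows "is_cokernel (ch C) k q"
proof (rule ch.is_cokernelI)
  note kD = ch_ArD[OF k] and qD = ch_ArD[OF q]
  note M = chain_complexD[OF qD(1)] and Q = chain_complexD[OF qD(2)]
  have epi: "epi_arr C (cmpt q i)" for i using coker by (rule is_cokernel_epi)
  show "epi_arr (ch C) q"
    unfolding epi_arr_def
  proof (intro conjI allI ballI impI)
    fix L u v assume "u \<in> Hom (ch C) (Cod (ch C) q) L" "v \<in> Hom (ch C) (Cod (ch C) q) L"
      and eq: "u \<cdot>\<^bsub>ch C\<^esub> q = v \<cdot>\<^bsub>ch C\<^esub> q"
    then have u: "u \<in> Ar (ch C)" "tgt u = L" "src u = tgt q" and v: "v \<in> Ar (ch C)" "tgt v = L" "src v = tgt q"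
      by auto
    show "u = v"
    proof (rule chain_map_eqI)
      fix i
      have "cmpt u i \<cdot> cmpt q i = cmpt v i \<cdot> cmpt q i" using eq by (auto dest: fun_cong)
      then show "cmpt u i = cmpt v i"
        by (rule epi_arrD[OF epi]) (use ch_ArD[OF u(1)] ch_ArD[OF v(1)] u v qD in auto)
    qed (use u v in auto)
  qed (rule q)
  have "q \<cdot>\<^bsub>ch C\<^esub> k \<in> Ar (ch C)" using k q kq by (intro ch.comp_simps) auto
  from zero_arr_ch_iff[OF this] show "zero_arr (ch C) (q \<cdot>\<^bsub>ch C\<^esub> k)"
    using is_cokernelD(4)[OF coker] by simp
  fix u assume u: "u \<in> Ar (ch C)" "Dom (ch C) u = Cod (ch C) k" "zero_arr (ch C) (u \<cdot>\<^bsub>ch C\<^esub> k)"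
  note uD = ch_ArD[OF u(1)]
  have su: "src u = src q" using u(2) kq by simp
  have "u \<cdot>\<^bsub>ch C\<^esub> k \<in> Ar (ch C)" using u k by (intro ch.comp_simps) auto
  from zero_arr_ch_iff[OF this] have "zero_arr C (cmpt u i \<cdot> cmpt k i)" for i
    using u(3) by simp
  then have "\<exists>h. h \<in> Ar C \<and> Dom C h = deg (tgt q) i \<and> Cod C h = deg (tgt u) i \<and> h \<cdot> cmpt q i = cmpt u i" for i
    by (rule is_cokernelE[OF coker]) (use uD kD qD su kq in auto)
  then obtain h where h: "\<And>i. h i \<in> Ar C" "\<And>i. Dom C (h i) = deg (tgt q) i"
    "\<And>i. Cod C (h i) = deg (tgt u) i" "\<And>i. h i \<cdot> cmpt q i = cmpt u i"
    by metis
  note U = chain_complexD[OF uD(2)]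
  have "bd (tgt u) i \<cdot> h i = h (i - 1) \<cdot> bd (tgt q) i" for i
  proof -
    have "(bd (tgt u) i \<cdot> h i) \<cdot> cmpt q i = bd (tgt u) i \<cdot> (h i \<cdot> cmpt q i)"
      using h(1-3) qD(3-5) U by simp
    also have "\<dots> = (h (i - 1) \<cdot> cmpt q (i - 1)) \<cdot> bd (src q) i"
      unfolding h(4) su[symmetric] by (rule uD(6))
    also have "\<dots> = h (i - 1) \<cdot> (cmpt q (i - 1) \<cdot> bd (src q) i)"
      using h(1-3) qD(3-5) M by simp
    also have "\<dots> = (h (i - 1) \<cdot> bd (tgt q) i) \<cdot> cmpt q i"
      unfolding qD(6)[symmetric] using h(1-3) qD(3-5) Q by simp
    finally show ?thesis
      by (rule epi_arrD[OF epi]) (use h(1-3) qD(3-5) U Q in auto)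
  qed
  then have "\<lparr>src = tgt q, tgt = tgt u, cmpt = h\<rparr> \<in> Ar (ch C)"
    using h qD uD by (auto intro!: ch_ArI)
  moreover have "\<lparr>src = tgt q, tgt = tgt u, cmpt = h\<rparr> \<cdot>\<^bsub>ch C\<^esub> q = u"
    using h(4) su by (intro chain_map_eqI) auto
  ultimately show "\<exists>h. h \<in> Ar (ch C) \<and> Dom (ch C) h = Cod (ch C) q \<and> Cod (ch C) h = Cod (ch C) u \<and>
      h \<cdot>\<^bsub>ch C\<^esub> q = u"
    by (intro exI[of _ "\<lparr>src = tgt q, tgt = tgt u, cmpt = h\<rparr>"]) simp
qed (use assms in auto)

end

section \<open>The torsion theories\<close>

lemma pch_simps [simp]:
  "Dom (pch C) = src" "Cod (pch C) = tgt" "Ob (pch C) = proper C"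
  "f \<in> Ar (pch C) \<longleftrightarrow> f \<in> Ar (ch C) \<and> src f \<in> proper C \<and> tgt f \<in> proper C"
proof -
  show "Dom (pch C) = src" "Cod (pch C) = tgt" by (simp_all add: pch_def full_subcat_def)
  show "Ob (pch C) = proper C" by (auto simp: pch_def full_subcat_def proper_def)
  show "f \<in> Ar (pch C) \<longleftrightarrow> f \<in> Ar (ch C) \<and> src f \<in> proper C \<and> tgt f \<in> proper C"
    by (auto simp: pch_def full_subcat_def)
qed

lemma properD:
  assumes "M \<in> proper C"
  shows "chain_complex C M" "proper_arr C (bd M i)"
  using assms by (simp_all add: proper_def)

context category
begin

text \<open>If \<open>m\<close> is a kernel of \<open>f\<close>, then \<open>f\<close> factors
  through \<open>c\<close>, so every arrow killed by \<open>c\<close> is killed by \<open>f\<close>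
  and factors through \<open>m\<close>.\<close>

lemma normal_mono_kernel_of_cokernel:
  assumes "normal_mono C m" "is_cokernel C m c"
  shows "is_kernel C c m"
proof (rule is_kernelI)
  note cD = is_cokernelD[OF assms(2)]
  obtain f where f: "is_kernel C f m" using assms(1) by (auto simp: normal_mono_def)
  note fD = is_kernelD[OF f]
  obtain h where h: "h \<in> Ar C" "Dom C h = Cod C c" "Cod C h = Cod C f" "h \<cdot> c = f"
    by (rule is_cokernelE[OF assms(2) fD(4)]) (use fD in auto)
  fix u assume u: "u \<in> Ar C" "Cod C u = Dom C c" "zero_arr C (c \<cdot> u)"
  have "zero_arr C (h \<cdot> (c \<cdot> u))"
    using u(1,2) h(1-3) cD(2) by (intro zero_arr_comp_left[OF u(3)]) auto
  also have "h \<cdot> (c \<cdot> u) = (h \<cdot> c) \<cdot> u" using u(1,2) h(1-3) cD(2) by simp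
  also have "\<dots> = f \<cdot> u" by (simp only: h(4))
  finally obtain t where "t \<in> Ar C" "Dom C t = Dom C u" "Cod C t = Dom C m" "m \<cdot> t = u"
    by (rule is_kernelE[OF f]) (use u cD fD in auto)
  then show "\<exists>t. t \<in> Ar C \<and> Dom C t = Dom C u \<and> Cod C t = Dom C m \<and> m \<cdot> t = u" by blast
qed (use is_cokernelD[OF assms(2)] normal_mono_mono[OF assms(1)] in auto)

end

context semi_abelian
begin

interpretation ch: category "ch C"
  by (rule category_ch)

text \<open>As \<open>e\<close> is epic, an arrow kills \<open>m\<close> exactly when it kills
  \<open>f\<close>.\<close>

lemma is_cokernel_image:
  assumes "is_cokernel C f c" "epi_arr C e" "m \<in> Ar C" "Dom C m = Cod C e" "m \<cdot> e = f"
  shows "is_cokernel C m c"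
proof (rule is_cokernelI)
  note cD = is_cokernelD[OF assms(1)]
  have e: "e \<in> Ar C" using assms(2) by (rule epi_arr_in)
  have cod: "Cod C f = Cod C m" using assms(3-5) e by auto
  show "Dom C c = Cod C m" using cD(3) cod by simp
  have "zero_arr C ((c \<cdot> m) \<cdot> e)"
    using cD(2-4) cod e assms(3-5) by simp
  then show "zero_arr C (c \<cdot> m)"
    by (rule epi_zero_cancel[OF assms(2)]) (use cD(2,3) cod assms(3,4) in auto)
  fix u assume u: "u \<in> Ar C" "Dom C u = Cod C m" "zero_arr C (u \<cdot> m)"
  have "zero_arr C ((u \<cdot> m) \<cdot> e)"
    using u(1,2) e assms(3,4) by (intro zero_arr_comp_right[OF u(3)]) auto
  then have "zero_arr C (u \<cdot> f)" using u(1,2) e assms(3-5) by simp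
  then obtain h where "h \<in> Ar C" "Dom C h = Cod C c" "Cod C h = Cod C u" "h \<cdot> c = u"
    by (rule is_cokernelE[OF assms(1)]) (use u cod in auto)
  then show "\<exists>h. h \<in> Ar C \<and> Dom C h = Cod C c \<and> Cod C h = Cod C u \<and> h \<cdot> c = u" by blast
qed (use assms(3) is_cokernel_epi[OF assms(1)] in auto)

text \<open>The constant zero complex is proper, so zero chain maps between proper complexes factor
  inside \<open>pch C\<close>.\<close>

lemma zero_arr_pch:
  assumes "f \<in> Ar (pch C)" "\<And>i. zero_arr C (cmpt f i)"
  shows "zero_arr (pch C) f"
proof -
  have z: "zero_obj C (the_zero C)" by (rule the_zero)
  have f: "f \<in> Ar (ch C)" "src f \<in> proper C" "tgt f \<in> proper C" using assms(1) by auto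
  have "proper_arr C (Id C (the_zero C))"
    using z by (intro proper_arr_zero zero_arr_to_zero) (auto simp: zero_obj_in)
  then have "const_chain C (the_zero C) \<in> proper C"
    using zero_chain_complex[OF z] by (simp add: proper_def) (simp add: const_chain_def)
  moreover have "zero_arr (ch C) f" using f assms(2) by (simp add: zero_arr_ch_iff)
  ultimately show ?thesis
    unfolding pch_def using f by (intro ch.full_subcat_zero_arr[OF zero_obj_ch[OF z]]) auto
qed

section \<open>Repleteness of the torsion and torsion-free classes\<close>

lemma isomorphic_pchE:
  assumes "isomorphic (pch C) M N"
  obtains f where "f \<in> Ar (ch C)" "src f = M" "tgt f = N" "\<And>i. iso_arr C (cmpt f i)"
proof -
  obtain f where f: "f \<in> Hom (pch C) M N" "iso_arr (pch C) f"
    using assms by (auto simp: isomorphic_def)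
  then have "iso_arr (ch C) f" unfolding pch_def by (intro ch.full_subcat_iso_arr)
  then show thesis using f that iso_arr_ch by auto
qed

lemma zero_deg_isomorphic:
  assumes "isomorphic (pch C) M N" "zero_obj C (deg M i)"
  shows "zero_obj C (deg N i)"
proof -
  obtain f where f: "f \<in> Ar (ch C)" "src f = M" "tgt f = N" "\<And>i. iso_arr C (cmpt f i)"
    using assms(1) by (rule isomorphic_pchE) blast
  then show ?thesis
    using zero_obj_iso[OF assms(2) f(4)] ch_ArD(4,5)[OF f(1)] by simp
qed

lemma full_replete_EP: "full_replete (pch C) (EP C n)"
  unfolding full_replete_def
proof (intro conjI ballI impI)
  show "EP C n \<subseteq> Ob (pch C)" by (auto simp: EP_def)
  fix M N assume M: "M \<in> EP C n" and N: "N \<in> Ob (pch C)" and iso: "isomorphic (pch C) M N"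
  obtain f where f: "f \<in> Ar (ch C)" "src f = M" "tgt f = N" "\<And>i. iso_arr C (cmpt f i)"
    using iso by (rule isomorphic_pchE) blast
  note fD = ch_ArD[OF f(1), unfolded f(2,3)]
  have "normal_epi C (bd N n)"
  proof (rule normal_epi_iso[OF _ f(4) f(4)])
    show "normal_epi C (bd M n)" using M by (simp add: EP_def)
    show "bd N n \<cdot> cmpt f n = cmpt f (n - 1) \<cdot> bd M n" by (rule fD(6))
  qed (use fD(3-5) chain_complexD[OF fD(1)] chain_complexD[OF fD(2)] in auto)
  then show "N \<in> EP C n"
    using M N zero_deg_isomorphic[OF iso] by (simp add: EP_def)
qed

lemma full_replete_pch_le: "full_replete (pch C) (pch_le C k)"
  unfolding full_replete_def pch_le_def using zero_deg_isomorphic by auto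

text \<open>\<open>u\<close> factors through the zero arrow \<open>c\<close>. This cancellation
  needs only a vanishing cokernel, which is weaker than \<open>f\<close> being epic.\<close>

lemma zero_arr_cokernel:
  assumes "is_cokernel C f c" "zero_arr C c" "u \<in> Ar C" "Dom C u = Cod C f" "zero_arr C (u \<cdot> f)"
  shows "zero_arr C u"
proof -
  note cD = is_cokernelD[OF assms(1)]
  obtain h where h: "h \<in> Ar C" "Dom C h = Cod C c" "Cod C h = Cod C u" "h \<cdot> c = u"
    by (rule is_cokernelE[OF assms(1,5,3,4)])
  have "zero_arr C (h \<cdot> c)" using h(1,2) by (intro zero_arr_comp_left[OF assms(2)])
  then show ?thesis by (simp only: h(4))
qed

section \<open>Vanishing of maps from torsion to torsion-free complexes\<close>

lemma TT1_ch: "TT1 (ch C) (Ker_cot C (n - 1)) (ch_le C (n - 1))"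
  unfolding TT1_def
proof (intro ballI)
  fix M N f assume M: "M \<in> Ker_cot C (n - 1)" and N: "N \<in> ch_le C (n - 1)" and "f \<in> Hom (ch C) M N"
  then have f: "f \<in> Ar (ch C)" "src f = M" "tgt f = N" by auto
  note fD = ch_ArD[OF f(1), unfolded f(2,3)]
  note MD = chain_complexD[OF fD(1)] and ND = chain_complexD[OF fD(2)]
  obtain Z g where Z: "zero_obj (ch C) Z" and g: "g \<in> Hom (ch C) (cot C (n - 1) M) Z" "iso_arr (ch C) g"
    using M by (auto simp: Ker_cot_def isomorphic_def)
  have cot: "zero_obj C (deg (cot C (n - 1) M) i)" for i
    using zero_obj_iso_dom[OF _ iso_arr_ch[OF g(2), of i]] zero_obj_ch_deg[OF Z, of i]
      ch_ArD(4,5)[of g C i] g(1) by auto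
  define c where "c = cok C (bd M n)"
  \<comment> \<open>\<open>cok\<close> is a choice, so its defining property rests on the existence
    of cokernels.\<close>
  have "\<exists>q. is_cokernel C (bd M n) q" using MD(2) cokernel_exists by metis
  then have c: "is_cokernel C (bd M n) c" unfolding c_def cok_def by (rule someI_ex)
  have "zero_obj C (Cod C c)" using cot[of "n - 1"] by (simp add: cot_def c_def Let_def)
  then have c0: "zero_arr C c" using is_cokernelD(2)[OF c] by (intro zero_arr_to_zero)
  have "zero_arr C (cmpt f i)" for i
  proof -
    consider "i > n - 1" | "i = n - 1" | "i < n - 1" by linarith
    then show ?thesis
    proof cases
      case 1
      then show ?thesis using N fD(3-5) by (intro zero_arr_to_zero) (auto simp: ch_le_def)
    next
      case 2
      \<comment> \<open>\<open>N\<close> already vanishes in degree \<open>n\<close>, so commutation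
        with the boundaries of index \<open>n\<close> shows that \<open>cmpt f (n - 1)\<close> kills
        \<open>bd M n\<close>.\<close>
      have "zero_obj C (deg N n)" using N by (simp add: ch_le_def)
      then have "zero_arr C (cmpt f n)" using fD(3-5) by (intro zero_arr_to_zero) auto
      then have "zero_arr C (bd N n \<cdot> cmpt f n)" using fD(3-5) ND by (intro zero_arr_comp_left) auto
      then have "zero_arr C (cmpt f (n - 1) \<cdot> bd M n)" by (simp only: fD(6))
      then have "zero_arr C (cmpt f (n - 1))"
        by (rule zero_arr_cokernel[OF c c0, rotated 2]) (use fD(3-5) MD in auto)
      then show ?thesis using 2 by simp
    next
      case 3
      then have "zero_obj C (deg M i)" using cot[of i] by (simp add: cot_def Let_def)
      then show ?thesis using fD(3-5) by (intro zero_arr_from_zero) auto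
    qed
  qed
  then show "zero_arr (ch C) f" using f(1) by (simp add: zero_arr_ch_iff)
qed

lemma TT1_pch: "TT1 (pch C) (EP C n) (pch_le C (n - 1))"
  unfolding TT1_def
proof (intro ballI)
  fix M N f assume M: "M \<in> EP C n" and N: "N \<in> pch_le C (n - 1)" and "f \<in> Hom (pch C) M N"
  then have f': "f \<in> Ar (pch C)" and f: "f \<in> Ar (ch C)" "src f = M" "tgt f = N" by auto
  note fD = ch_ArD[OF f(1), unfolded f(2,3)]
  note MD = chain_complexD[OF fD(1)] and ND = chain_complexD[OF fD(2)]
  have epi: "epi_arr C (bd M n)" using M by (auto simp: EP_def intro: normal_epi_epi)
  have "zero_arr C (cmpt f i)" for i
  proof -
    consider "i > n - 1" | "i = n - 1" | "i < n - 1" by linarith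
    then show ?thesis
    proof cases
      case 1
      then show ?thesis using N fD(3-5) by (intro zero_arr_to_zero) (auto simp: pch_le_def)
    next
      case 2
      have "zero_obj C (deg N n)" using N by (simp add: pch_le_def)
      then have "zero_arr C (cmpt f n)" using fD(3-5) by (intro zero_arr_to_zero) auto
      then have "zero_arr C (bd N n \<cdot> cmpt f n)" using fD(3-5) ND by (intro zero_arr_comp_left) auto
      then have "zero_arr C (cmpt f (n - 1) \<cdot> bd M n)" by (simp only: fD(6))
      then have "zero_arr C (cmpt f (n - 1))"
        by (rule epi_zero_cancel[OF epi]) (use fD(3-5) MD in auto)
      then show ?thesis using 2 by simp
    next
      case 3
      then have "zero_obj C (deg M i)" using M by (simp add: EP_def)
      then show ?thesis using fD(3-5) by (intro zero_arr_from_zero) auto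
    qed
  qed
  then show "zero_arr (pch C) f" using f' by (intro zero_arr_pch)
qed

section \<open>The torsion decomposition of a proper complex\<close>

lemma TT2_pch: "TT2 (pch C) (short_exact_pch C) (EP C n) (pch_le C (n - 1))"
  unfolding TT2_def
proof
  fix M assume "M \<in> Ob (pch C)"
  then have M: "M \<in> proper C" by simp
  note Mcc = properD(1)[OF M] and Mp = properD(2)[OF M]
  note MD = chain_complexD[OF Mcc]
  let ?Z = "the_zero C"
  have z: "zero_obj C ?Z" by (rule the_zero)
  then have zOb: "?Z \<in> Ob C" by (rule zero_obj_in)
  obtain e m where em: "normal_epi C e" "mono_arr C m" "e \<in> Ar C" "m \<in> Ar C" "Dom C e = Dom C (bd M n)"
    "Cod C m = Cod C (bd M n)" "Dom C m = Cod C e" "m \<cdot> e = bd M n"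
    using MD(2) by (rule normal_factorization)
  have emD: "Dom C e = deg M n" "Cod C m = deg M (n - 1)" using em MD by auto
  have epi_e: "epi_arr C e" using em(1) by (rule normal_epi_epi)
  \<comment> \<open>Properness of \<open>M\<close> turns the image of \<open>bd M n\<close> into a
    kernel.\<close>
  have m_normal: "normal_mono C m" using Mp[of n] em(1,2,7,8) unfolding proper_arr_def by metis
  obtain c where c: "is_cokernel C (bd M n) c" using MD(2) by (rule cokernel_exists)
  have cD: "c \<in> Ar C" "Dom C c = deg M (n - 1)" "zero_arr C (c \<cdot> bd M n)"
    using is_cokernelD[OF c] MD by auto
  have c_normal: "normal_epi C c" using c by (auto simp: normal_epi_def)
  have epi_c: "epi_arr C c" using c by (rule is_cokernel_epi)
  have MM: "zero_arr C (bd M (n - 1) \<cdot> bd M n)" using MD(5)[of "n - 1"] by simp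
  obtain d where d: "d \<in> Ar C" "Dom C d = Cod C c" "Cod C d = deg M (n - 2)" "d \<cdot> c = bd M (n - 1)"
    by (rule is_cokernelE[OF c MM]) (use MD in auto)
  have m_coker: "is_cokernel C m c" by (rule is_cokernel_image[OF c epi_e em(4,7,8)])
  have m_ker: "is_kernel C c m" by (rule normal_mono_kernel_of_cokernel[OF m_normal m_coker])

  \<comment> \<open>The zero boundaries reach up to index \<open>n - 1\<close>, although the image
    lives in degree \<open>n - 1\<close>: the boundary of that index ends in degree
    \<open>n - 2\<close>, where \<open>T\<close> vanishes.\<close>
  define T where "T = \<lparr>deg = (\<lambda>i. if i < n - 1 then ?Z else if i = n - 1 then Cod C e else deg M i),
    bd = (\<lambda>i. if i < n then the_zero_arr C (if i < n - 1 then ?Z else Cod C e) ?Z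
               else if i = n then e else bd M i)\<rparr>"
  have Tdeg: "i < n - 1 \<Longrightarrow> deg T i = ?Z" "deg T (n - 1) = Cod C e" "i \<ge> n \<Longrightarrow> deg T i = deg M i"
    and Tbd: "i < n \<Longrightarrow> bd T i = the_zero_arr C (deg T i) ?Z" "bd T n = e" "i > n \<Longrightarrow> bd T i = bd M i" for i
    by (auto simp: T_def)
  have T_Ob: "deg T i \<in> Ob C" for i using zOb MD(1) em(3) by (auto simp: T_def)
  have T_bd: "bd T i \<in> Ar C" "Dom C (bd T i) = deg T i" "Cod C (bd T i) = deg T (i - 1)" for i
  proof -
    have "bd T i \<in> Ar C \<and> Dom C (bd T i) = deg T i \<and> Cod C (bd T i) = deg T (i - 1)"
    proof (cases i n rule: linorder_cases)
      case less
      then show ?thesis using Tbd(1) Tdeg(1)[of "i - 1"] the_zero_arr[OF T_Ob zOb] by simp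
    next
      case equal
      then show ?thesis using Tbd(2) Tdeg(2) Tdeg(3)[of n] em(3) emD by simp
    next
      case greater
      then show ?thesis using Tbd(3) Tdeg(3)[of i] Tdeg(3)[of "i - 1"] MD by simp
    qed
    then show "bd T i \<in> Ar C" "Dom C (bd T i) = deg T i" "Cod C (bd T i) = deg T (i - 1)" by auto
  qed
  have T_zero: "zero_arr C (bd T i)" if "i < n" for i
    using Tbd(1)[OF that] the_zero_arr(4)[OF T_Ob zOb] by simp
  have "zero_arr C (bd T i \<cdot> bd T (i + 1))" for i
  proof (cases i n rule: linorder_cases)
    case less
    then show ?thesis using T_zero T_bd by (intro zero_arr_comp_right) auto
  next
    case equal
    \<comment> \<open>\<open>bd M n\<close> kills \<open>bd M (n + 1)\<close>, and cancelling
      \<open>m\<close> gives the same for \<open>e\<close>.\<close>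
    have "m \<cdot> (e \<cdot> bd M (n + 1)) = (m \<cdot> e) \<cdot> bd M (n + 1)" using em(3,4,7) emD MD by simp
    also have "\<dots> = bd M n \<cdot> bd M (n + 1)" by (simp only: em(8))
    also have "zero_arr C \<dots>" by (rule MD(5))
    finally have "zero_arr C (e \<cdot> bd M (n + 1))"
      by (rule mono_zero_cancel[OF em(2)]) (use em(3,7) emD MD in auto)
    then show ?thesis using equal Tbd(2) Tbd(3)[of "n + 1"] by simp
  next
    case greater
    then show ?thesis using Tbd(3)[of i] Tbd(3)[of "i + 1"] MD(5) by simp
  qed
  then have T_cc: "chain_complex C T"
    using T_Ob T_bd by (simp add: chain_complex_def)
  have "proper_arr C (bd T i)" for i
    using T_zero proper_arr_zero proper_arr_normal_epi[OF em(1)] Tbd(2) Tbd(3)[of i] Mp[of i]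
    by (cases i n rule: linorder_cases) auto
  then have T_proper: "T \<in> proper C" using T_cc by (simp add: proper_def)
  have T_EP: "T \<in> EP C n" using T_proper Tbd(2) em(1) Tdeg(1) z by (simp add: EP_def)

  \<comment> \<open>The boundary of index \<open>n\<close> is a zero arrow ending in the cokernel
    rather than in \<open>?Z\<close>, hence the inner case distinction.\<close>
  define F where "F = \<lparr>deg = (\<lambda>i. if i < n - 1 then deg M i else if i = n - 1 then Cod C c else ?Z),
    bd = (\<lambda>i. if i < n - 1 then bd M i else if i = n - 1 then d
               else the_zero_arr C ?Z (if i = n then Cod C c else ?Z))\<rparr>"
  have Fdeg: "i < n - 1 \<Longrightarrow> deg F i = deg M i" "deg F (n - 1) = Cod C c" "i \<ge> n \<Longrightarrow> deg F i = ?Z"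
    and Fbd: "i < n - 1 \<Longrightarrow> bd F i = bd M i" "bd F (n - 1) = d"
      "i \<ge> n \<Longrightarrow> bd F i = the_zero_arr C ?Z (deg F (i - 1))" for i
    by (auto simp: F_def)
  have F_Ob: "deg F i \<in> Ob C" for i using zOb MD(1) cD(1) by (auto simp: F_def)
  have F_bd: "bd F i \<in> Ar C" "Dom C (bd F i) = deg F i" "Cod C (bd F i) = deg F (i - 1)" for i
  proof -
    have "bd F i \<in> Ar C \<and> Dom C (bd F i) = deg F i \<and> Cod C (bd F i) = deg F (i - 1)"
    proof (cases i "n - 1" rule: linorder_cases)
      case less
      then show ?thesis using Fbd(1) Fdeg(1)[of i] Fdeg(1)[of "i - 1"] MD by simp
    next
      case equal
      then show ?thesis using Fbd(2) Fdeg(2) Fdeg(1)[of "n - 2"] d by simp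
    next
      case greater
      then show ?thesis using Fbd(3)[of i] Fdeg(3)[of i] the_zero_arr[OF zOb F_Ob] by simp
    qed
    then show "bd F i \<in> Ar C" "Dom C (bd F i) = deg F i" "Cod C (bd F i) = deg F (i - 1)" by auto
  qed
  have F_zero: "zero_arr C (bd F i)" if "i \<ge> n" for i
    using Fbd(3)[OF that] the_zero_arr(4)[OF zOb F_Ob] by simp
  have "zero_arr C (bd F i \<cdot> bd F (i + 1))" for i
  proof (cases i "n - 2" rule: linorder_cases)
    case less
    then show ?thesis using Fbd(1)[of i] Fbd(1)[of "i + 1"] MD(5) by simp
  next
    case equal
    \<comment> \<open>The boundary condition for \<open>d\<close> holds after composition with the
      epimorphism \<open>c\<close>.\<close>
    have "(bd M (n - 2) \<cdot> d) \<cdot> c = bd M (n - 2) \<cdot> bd M (n - 1)"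
      using d cD(1,2) MD by simp
    then have "zero_arr C ((bd M (n - 2) \<cdot> d) \<cdot> c)" using MD(5)[of "n - 2"] by simp
    then have "zero_arr C (bd M (n - 2) \<cdot> d)"
      by (rule epi_zero_cancel[OF epi_c]) (use d(1-3) cD(1) MD in auto)
    then show ?thesis using equal Fbd(2) Fbd(1)[of "n - 2"] by simp
  next
    case greater
    then show ?thesis using F_zero[of "i + 1"] F_bd by (intro zero_arr_comp_left) auto
  qed
  then have F_cc: "chain_complex C F"
    using F_Ob F_bd by (simp add: chain_complex_def)
  \<comment> \<open>\<open>c\<close> is a normal epimorphism, so \<open>d\<close> has the same image
    as the proper arrow \<open>bd M (n - 1)\<close>.\<close>
  have "proper_arr C d"
    by (rule proper_arr_descend[OF Mp MD(2) c_normal d(1,2,4)])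
  then have "proper_arr C (bd F i)" for i
    using F_zero[of i] proper_arr_zero Fbd(1)[of i] Fbd(2) Mp[of i]
    by (cases i "n - 1" rule: linorder_cases) auto
  then have F_proper: "F \<in> proper C" using F_cc by (simp add: proper_def)
  have F_le: "F \<in> pch_le C (n - 1)" using F_proper Fdeg(3) z by (simp add: pch_le_def)

  define k where "k = \<lparr>src = T, tgt = M, cmpt = (\<lambda>i. if i < n - 1 then the_zero_arr C ?Z (deg M i)
    else if i = n - 1 then m else Id C (deg M i))\<rparr>"
  have kc: "i < n - 1 \<Longrightarrow> cmpt k i = the_zero_arr C ?Z (deg M i)" "cmpt k (n - 1) = m"
    "i \<ge> n \<Longrightarrow> cmpt k i = Id C (deg M i)" for i
    by (auto simp: k_def)
  have k_Ar: "cmpt k i \<in> Ar C" "Dom C (cmpt k i) = deg T i" "Cod C (cmpt k i) = deg M i" for i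
  proof -
    have "cmpt k i \<in> Ar C \<and> Dom C (cmpt k i) = deg T i \<and> Cod C (cmpt k i) = deg M i"
    proof (cases i "n - 1" rule: linorder_cases)
      case less
      then show ?thesis using kc(1) Tdeg(1) the_zero_arr[OF zOb MD(1)] by simp
    next
      case equal
      then show ?thesis using kc(2) Tdeg(2) em(4,7) emD by simp
    next
      case greater
      then show ?thesis using kc(3)[of i] Tdeg(3)[of i] MD(1) by simp
    qed
    then show "cmpt k i \<in> Ar C" "Dom C (cmpt k i) = deg T i" "Cod C (cmpt k i) = deg M i" by auto
  qed
  have "bd M i \<cdot> cmpt k i = cmpt k (i - 1) \<cdot> bd T i" for i
  proof (cases i n rule: linorder_cases)
    case less
    have "zero_arr C (bd M i \<cdot> cmpt k i)"
    proof (cases "i = n - 1")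
      case True
      \<comment> \<open>\<open>T\<close> has a zero boundary out of degree \<open>n - 1\<close>, so
        \<open>bd M (n - 1)\<close> must vanish on the image \<open>m\<close>; it does so after
        composition with the epimorphism \<open>e\<close>.\<close>
      have "(bd M (n - 1) \<cdot> m) \<cdot> e = bd M (n - 1) \<cdot> bd M n" using em(3,4,7,8) emD MD by simp
      then have "zero_arr C ((bd M (n - 1) \<cdot> m) \<cdot> e)" using MM by simp
      then have "zero_arr C (bd M (n - 1) \<cdot> m)"
        by (rule epi_zero_cancel[OF epi_e]) (use em(4,7) emD MD in auto)
      then show ?thesis using True kc(2) by simp
    next
      case False
      then have "zero_arr C (cmpt k i)" using less kc(1)[of i] the_zero_arr(4)[OF zOb MD(1)] by simp
      then show ?thesis using k_Ar MD by (intro zero_arr_comp_left) auto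
    qed
    moreover have "zero_arr C (cmpt k (i - 1) \<cdot> bd T i)"
      using T_zero[OF less] k_Ar T_bd by (intro zero_arr_comp_left) auto
    ultimately show ?thesis using k_Ar T_bd MD by (intro zero_arr_unique) auto
  next
    case equal
    then show ?thesis using kc(2) kc(3)[of n] Tbd(2) em(8) MD by simp
  next
    case greater
    then show ?thesis using kc(3)[of i] kc(3)[of "i - 1"] Tbd(3)[of i] MD by simp
  qed
  then have k: "k \<in> Ar (ch C)"
    using k_Ar T_cc Mcc by (intro ch_ArI) (auto simp: k_def)

  define q where "q = \<lparr>src = M, tgt = F, cmpt = (\<lambda>i. if i < n - 1 then Id C (deg M i)
    else if i = n - 1 then c else the_zero_arr C (deg M i) ?Z)\<rparr>"
  have qc: "i < n - 1 \<Longrightarrow> cmpt q i = Id C (deg M i)" "cmpt q (n - 1) = c"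
    "i \<ge> n \<Longrightarrow> cmpt q i = the_zero_arr C (deg M i) ?Z" for i
    by (auto simp: q_def)
  have q_Ar: "cmpt q i \<in> Ar C" "Dom C (cmpt q i) = deg M i" "Cod C (cmpt q i) = deg F i" for i
  proof -
    have "cmpt q i \<in> Ar C \<and> Dom C (cmpt q i) = deg M i \<and> Cod C (cmpt q i) = deg F i"
    proof (cases i "n - 1" rule: linorder_cases)
      case less
      then show ?thesis using qc(1) Fdeg(1) MD(1) by simp
    next
      case equal
      then show ?thesis using qc(2) Fdeg(2) cD by simp
    next
      case greater
      then show ?thesis using qc(3)[of i] Fdeg(3)[of i] the_zero_arr[OF MD(1) zOb] by simp
    qed
    then show "cmpt q i \<in> Ar C" "Dom C (cmpt q i) = deg M i" "Cod C (cmpt q i) = deg F i" by auto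
  qed
  have q_zero: "zero_arr C (cmpt q i)" if "i \<ge> n" for i
    using qc(3)[OF that] the_zero_arr(4)[OF MD(1) zOb] by simp
  have "bd F i \<cdot> cmpt q i = cmpt q (i - 1) \<cdot> bd M i" for i
  proof (cases i "n - 1" rule: linorder_cases)
    case less
    then show ?thesis using qc(1)[of i] qc(1)[of "i - 1"] Fbd(1)[of i] MD by simp
  next
    case equal
    then show ?thesis using qc(2) qc(1)[of "n - 2"] Fbd(2) d(4) MD by simp
  next
    case greater
    then have "zero_arr C (bd F i \<cdot> cmpt q i)"
      using F_zero[of i] F_bd q_Ar by (intro zero_arr_comp_right) auto
    moreover have "zero_arr C (cmpt q (i - 1) \<cdot> bd M i)"
    \<comment> \<open>At index \<open>n\<close> the composite is zero because \<open>c\<close> is a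
      cokernel of \<open>bd M n\<close>, above it because the component of \<open>q\<close> in
      degree \<open>i - 1\<close> is zero.\<close>
    proof (cases "i = n")
      case True
      then show ?thesis using cD(3) qc(2) by simp
    next
      case False
      then show ?thesis using greater q_zero[of "i - 1"] q_Ar MD by (intro zero_arr_comp_right) auto
    qed
    ultimately show ?thesis using q_Ar F_bd MD by (intro zero_arr_unique) auto
  qed
  then have q: "q \<in> Ar (ch C)"
    using q_Ar F_cc Mcc by (intro ch_ArI) (auto simp: q_def)

  \<comment> \<open>Below degree \<open>n - 1\<close> the complex \<open>T\<close> vanishes and
    \<open>q\<close> is the identity; above it \<open>F\<close> vanishes and \<open>k\<close> is the
    identity. Only degree \<open>n - 1\<close> depends on normality of the image.\<close>
  have deg_exact: "is_kernel C (cmpt q i) (cmpt k i) \<and> is_cokernel C (cmpt k i) (cmpt q i)" for i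
  proof (cases i "n - 1" rule: linorder_cases)
    case less
    then show ?thesis
      using is_kernel_of_Id[of "cmpt k i"] is_cokernel_Id[of "cmpt k i"] k_Ar qc(1) Tdeg(1) z by simp
  next
    case equal
    then show ?thesis using m_ker m_coker kc(2) qc(2) by simp
  next
    case greater
    then show ?thesis
      using is_kernel_Id[of "cmpt q i"] is_cokernel_of_Id[of "cmpt q i"] q_zero[of i]
        q_Ar kc(3)[of i] Fdeg(3)[of i] z by simp
  qed
  have st: "src k = T" "tgt k = M" "src q = M" "tgt q = F" by (simp_all add: k_def q_def)
  have "short_exact (ch C) k q"
    unfolding short_exact_def using deg_exact k q st by (intro conjI is_kernel_ch is_cokernel_ch) auto
  then have "short_exact_pch C k q"
    using st T_proper M F_proper by (simp add: short_exact_pch_def)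
  moreover have "k \<in> Hom (pch C) T M" "q \<in> Hom (pch C) M F"
    using k q st T_proper M F_proper by auto
  ultimately show "\<exists>t\<in>EP C n. \<exists>y\<in>pch_le C (n - 1). \<exists>k\<in>Hom (pch C) t M. \<exists>q\<in>Hom (pch C) M y. short_exact_pch C k q"
    using T_EP F_le by blast
qed

end

theorem theorem3p9:
  fixes X :: "('o, 'm) cat" and n :: int
  assumes "semi_abelian X"
  shows "TT1 (ch X) (Ker_cot X (n - 1)) (ch_le X (n - 1)) \<and>
    torsion_theory (pch X) (short_exact_pch X) (EP X n) (pch_le X (n - 1))"
proof -
  interpret semi_abelian X by (rule assms)
  show ?thesis
    unfolding torsion_theory_def
    using TT1_ch full_replete_EP full_replete_pch_le TT1_pch TT2_pch by blast
qed

end
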